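(* Let $A$ be a matrix over a (finite or infinite) field $\mathbb{F}$. The branch-depth $\operatorname{bd}(A)$ of $A$ is equal to the minimum dual tree-depth $\operatorname{td}_D(A')$ of any matrix $A'$ that is row-equivalent to $A$.
   Context: Depth and height: the depth of a rooted tree is the maximum number of edges on a path from the root to a leaf; the height of a rooted tree is the maximum number of vertices on such a path, and the height of a rooted forest is the maximum height of one of its trees. A leaf is a vertex with no children. Tree-depth: the closure $\operatorname{cl}(F)$ of a rooted forest $F$ is the graph obtained by adding edges from each vertex to all its descendants. The tree-depth $\operatorname{td}(G)$ of a graph $G$ is the minimum height of a rooted forest $F$ such that $\operatorname{cl}(F)$ contains $G$ as a subgraph. Dual tree-depth: the dual graph $G_D(A)$ of an $m\times n$ matrix $A$ has vertex set $\{1,\ldots,m\}$ (the rows), two distinct vertices $i,i'$ being adjacent if $A$ contains a column whose $i$-th and $i'$-th entries are both non-zero. The dual tree-depth is $\operatorname{td}_D(A)=\operatorname{td}(G_D(A))$. Branch-depth: a depth-decomposition of a matroid $M=(X,\mathcal{I})$ with rank function $r$ is a pair $(T,f)$ where $T$ is a rooted tree with exactly $r(M)$ edges and $f$ maps $X$ to the leaves of $T$, such that for every $X'\subseteq X$ the rank $r(X')$ is at most the number of edges contained in the union of the paths from the root to the vertices $f(x)$, $x\in X'$. The branch-depth $\operatorname{bd}(M)$ is the smallest depth of a tree $T$ forming a depth-decomposition of $M$. The branch-depth $\operatorname{bd}(A)$ of a matrix $A$ is the branch-depth of the vector matroid whose elements are the columns of $A$ (independence being linear independence).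
   Formalization: The matrix A is assumed to be non-zero: for a zero matrix with at least one row the branch-depth is 0, while the dual tree-depth of its only row-equivalent matrix (itself) is 1, so the equality fails. *)

theory Defs
  imports "HOL-Analysis.Analysis" "Graph_Theory.Digraph_Isomorphism"
begin

section \<open>Rooted forests\<close>

text \<open>
  Arcs of a rooted forest point from parents to children. A finite rooted forest has exactly one
  root in each of its components, so a rooted tree is a rooted forest with a single root.
\<close>

definition rooted_forest :: "'v pair_pre_digraph \<Rightarrow> bool" where
  "rooted_forest F \<longleftrightarrow>
     pair_fin_digraph F \<and> acyclic (parcs F) \<and> (\<forall>v\<in>pverts F. in_degree (with_proj F) v \<le> 1)"

definition roots :: "'v pair_pre_digraph \<Rightarrow> 'v set" where
  "roots F = {v \<in> pverts F. in_degree (with_proj F) v = 0}"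

definition leaves :: "'v pair_pre_digraph \<Rightarrow> 'v set" where
  "leaves F = {v \<in> pverts F. out_degree (with_proj F) v = 0}"

definition rooted_tree :: "'v pair_pre_digraph \<Rightarrow> bool" where
  "rooted_tree T \<longleftrightarrow> rooted_forest T \<and> card (roots T) = 1"

text \<open>Paths are lists of arcs, so \<^term>\<open>length p\<close> is a number of edges.\<close>

definition root_leaf_paths :: "'v pair_pre_digraph \<Rightarrow> ('v \<times> 'v) awalk set" where
  "root_leaf_paths F =
     {p. \<exists>r\<in>roots F. \<exists>l\<in>leaves F. pre_digraph.apath (with_proj F) r p l}"

definition depth :: "'v pair_pre_digraph \<Rightarrow> nat" where
  "depth T = (SUP p\<in>root_leaf_paths T. length p)"

text \<open>
  A path with \<^term>\<open>length p\<close> edges has \<^term>\<open>Suc (length p)\<close> vertices. On natural numbers, the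
  supremum of a finite nonempty set is its maximum and that of the empty set is 0; hence the
  forest without vertices has height 0.
\<close>

definition height :: "'v pair_pre_digraph \<Rightarrow> nat" where
  "height F = (SUP p\<in>root_leaf_paths F. Suc (length p))"


section \<open>Tree-depth\<close>

text \<open>Undirected graphs are symmetric digraphs.\<close>

definition forest_closure :: "'v pair_pre_digraph \<Rightarrow> 'v pair_pre_digraph" where
  "forest_closure F =
     \<lparr>pverts = pverts F, parcs = {(u, v). (u, v) \<in> (parcs F)\<^sup>+ \<or> (v, u) \<in> (parcs F)\<^sup>+}\<rparr>"

text \<open>
  Forests range over all finite forests up to isomorphism, since their vertices are natural
  numbers; in particular they may have more vertices than \<open>G\<close>.
\<close>

definition tree_depth :: "'v pair_pre_digraph \<Rightarrow> nat" where
  "tree_depth G = (LEAST h. \<exists>(F :: nat pair_pre_digraph) H.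
     rooted_forest F \<and> digraph_iso (with_proj G) H \<and>
     subgraph H (with_proj (forest_closure F)) \<and> height F = h)"

definition dual_graph :: "'a::zero ^ 'n ^ 'm \<Rightarrow> 'm pair_pre_digraph" where
  "dual_graph A =
     \<lparr>pverts = UNIV, parcs = {(i, i'). i \<noteq> i' \<and> (\<exists>j. A $ i $ j \<noteq> 0 \<and> A $ i' $ j \<noteq> 0)}\<rparr>"

definition dual_tree_depth :: "'a::zero ^ 'n ^ 'm \<Rightarrow> nat" where
  "dual_tree_depth A = tree_depth (dual_graph A)"


section \<open>Branch-depth\<close>

locale matroid =
  fixes X :: "'x set" and \<I> :: "'x set set"
  assumes finite_ground: "finite X"
    and indep_subset_ground: "J \<in> \<I> \<Longrightarrow> J \<subseteq> X"
    and indep_empty: "{} \<in> \<I>"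
    and indep_subset: "J \<in> \<I> \<Longrightarrow> K \<subseteq> J \<Longrightarrow> K \<in> \<I>"
    and augmentation:
      "J \<in> \<I> \<Longrightarrow> K \<in> \<I> \<Longrightarrow> card J < card K \<Longrightarrow> \<exists>x\<in>K - J. insert x J \<in> \<I>"

definition matroid_rank :: "'x set set \<Rightarrow> 'x set \<Rightarrow> nat" where
  "matroid_rank \<I> S = Max (card ` {J \<in> \<I>. J \<subseteq> S})"

definition root_path_arcs :: "'v pair_pre_digraph \<Rightarrow> 'v \<Rightarrow> ('v \<times> 'v) set" where
  "root_path_arcs T v = \<Union>{set p | r p. r \<in> roots T \<and> pre_digraph.apath (with_proj T) r p v}"

definition depth_decomposition ::
  "'x set \<Rightarrow> 'x set set \<Rightarrow> 'v pair_pre_digraph \<Rightarrow> ('x \<Rightarrow> 'v) \<Rightarrow> bool" where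
  "depth_decomposition X \<I> T f \<longleftrightarrow>
     rooted_tree T \<and> card (parcs T) = matroid_rank \<I> X \<and> f ` X \<subseteq> leaves T \<and>
     (\<forall>X'\<subseteq>X. matroid_rank \<I> X' \<le> card (\<Union>x\<in>X'. root_path_arcs T (f x)))"

definition branch_depth :: "'x set \<Rightarrow> 'x set set \<Rightarrow> nat" where
  "branch_depth X \<I> = (LEAST d. \<exists>(T :: nat pair_pre_digraph) f.
     depth_decomposition X \<I> T f \<and> depth T = d)"

text \<open>
  The elements of the vector matroid are the column indices, so equal columns at different
  positions are different (parallel) elements; this is why injectivity is required.
\<close>

definition column_indep :: "'a::field ^ 'n ^ 'm \<Rightarrow> 'n set set" where
  "column_indep A =
     {J. inj_on (\<lambda>j. column j A) J \<and> vec.independent ((\<lambda>j. column j A) ` J)}"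

lemma matroid_column_indep: "matroid UNIV (column_indep A)"
proof
  show "{} \<in> column_indep A"
    by (simp add: column_indep_def vec.independent_empty)
next
  fix J K assume "J \<in> column_indep A" "K \<subseteq> J"
  then show "K \<in> column_indep A"
    unfolding column_indep_def by (auto intro: inj_on_subset dest: vec.independent_mono[OF _ image_mono])
next
  fix J K assume J: "J \<in> column_indep A" and K: "K \<in> column_indep A" and less: "card J < card K"
  let ?c = "\<lambda>j. column j A"
  show "\<exists>x\<in>K - J. insert x J \<in> column_indep A"
  proof (rule ccontr)
    assume none: "\<not> ?thesis"
    have "?c k \<in> vec.span (?c ` J)" if "k \<in> K" for k
    proof (rule ccontr)
      assume nspan: "?c k \<notin> vec.span (?c ` J)"
      then have "k \<notin> J" "?c k \<notin> ?c ` J"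
        by (auto intro: vec.span_base)
      moreover have "vec.independent (insert (?c k) (?c ` J))"
        using J nspan by (intro vec.independent_insertI) (simp_all add: column_indep_def)
      ultimately have "insert k J \<in> column_indep A"
        using J by (auto simp: column_indep_def)
      then show False
        using none \<open>k \<in> K\<close> \<open>k \<notin> J\<close> by blast
    qed
    then have "card (?c ` K) \<le> card (?c ` J)"
      using K by (intro conjunct2[OF vec.independent_span_bound]) (auto simp: column_indep_def)
    then show False
      using J K less by (simp add: column_indep_def card_image)
  qed
qed auto

definition matrix_branch_depth :: "'a::field ^ 'n ^ 'm \<Rightarrow> nat" where
  "matrix_branch_depth A = branch_depth UNIV (column_indep A)"


section \<open>Row equivalence\<close>

inductive elementary_row_operation :: "'a::field ^ 'n ^ 'm \<Rightarrow> 'a ^ 'n ^ 'm \<Rightarrow> bool" where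
  swap_rows: "elementary_row_operation A (\<chi> k. row (Transposition.transpose i j k) A)"
| scale_row: "c \<noteq> 0 \<Longrightarrow>
    elementary_row_operation A (\<chi> k. if k = i then c *s row i A else row k A)"
| add_row: "i \<noteq> j \<Longrightarrow>
    elementary_row_operation A (\<chi> k. if k = i then row i A + c *s row j A else row k A)"

definition row_equivalent :: "'a::field ^ 'n ^ 'm \<Rightarrow> 'a ^ 'n ^ 'm \<Rightarrow> bool" where
  "row_equivalent A A' \<longleftrightarrow> elementary_row_operation\<^sup>*\<^sup>* A A'"

end

theory Submission
  imports Defs
begin

text \<open>
  Everything depends only on the row space \<open>R\<close> of \<open>A\<close>: the rank of a set \<open>S\<close> of columns is the
  dimension of the restriction of \<open>R\<close> to \<open>S\<close>.

  Given \<open>A'\<close> and a forest \<open>F\<close> whose closure contains its dual graph, choose a row basis of \<open>A'\<close>,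
  order it by the ancestor relation of \<open>F\<close> and add a new root below all of it. The basis rows that
  are non-zero in a given column are pairwise adjacent, hence form a chain, and the column is sent to
  a leaf beyond this chain.

  Conversely, given a depth-decomposition \<open>(T, f)\<close>, let \<open>X e\<close> be the set of columns sent to leaves
  beyond the edge \<open>e\<close>. As \<open>T\<close> has exactly \<open>dim R\<close> edges, applying the rank condition to the
  complement of \<open>X e\<close> shows that the vectors of \<open>R\<close> supported in \<open>X e\<close> form a space of dimension at
  least the number of edges weakly below \<open>e\<close>. So one can choose, from the leaves upwards, independent
  vectors of \<open>R\<close>, the one of \<open>e\<close> being supported in \<open>X e\<close>. They are a basis of \<open>R\<close>, and vectors of
  incomparable edges have disjoint supports.
\<close>

section \<open>Ranks and the row space\<close>

text \<open>Coordinates outside \<open>S\<close> are zeroed rather than dropped, so the index type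
  stays fixed and "supported in \<open>S\<close>" becomes the fixed-point equation
  \<open>restrict_to S x = x\<close>.\<close>

definition restrict_to :: "'n set \<Rightarrow> 'a::zero ^ 'n \<Rightarrow> 'a ^ 'n" where
  "restrict_to S x = (\<chi> j. if j \<in> S then x $ j else 0)"

lemma restrict_to_nth [simp]: "restrict_to S x $ j = (if j \<in> S then x $ j else 0)"
  by (simp add: restrict_to_def)

lemma linear_restrict_to: "Vector_Spaces.linear (*s) (*s) (restrict_to S :: 'a::field ^ 'n \<Rightarrow> _)"
  by unfold_locales (auto simp: vec_eq_iff algebra_simps)

text \<open>Write each row in a basis \<open>B\<close> of the row space. Read columnwise, the same
  identities express every column through the coefficient vectors \<open>\<chi> i. c i b\<close>,
  one for each \<open>b \<in> B\<close>.\<close>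

lemma dim_columns_le_dim_rows:
  fixes M :: "'a::field ^ 'n ^ 'm"
  shows "vec.dim (columns M) \<le> vec.dim (rows M)"
proof -
  obtain B where B: "B \<subseteq> rows M" "vec.independent B" "rows M \<subseteq> vec.span B" "card B = vec.dim (rows M)"
    using vec.basis_exists by blast
  have fin: "finite B"
    using B(2) vec.finiteI_independent by blast
  have "\<exists>c. row i M = (\<Sum>b\<in>B. c b *s b)" for i
  proof -
    have "row i M \<in> vec.span B"
      using B(3) by (auto simp: rows_def)
    then show ?thesis
      by (auto simp: vec.span_finite[OF fin])
  qed
  then obtain c where c: "\<And>i. row i M = (\<Sum>b\<in>B. c i b *s b)"
    by metis
  have "column j M = (\<Sum>b\<in>B. (b $ j) *s (\<chi> i. c i b))" for j
  proof -
    have "M $ i $ j = (\<Sum>b\<in>B. c i b * b $ j)" for i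
      using arg_cong[OF c[of i], of "\<lambda>v. v $ j"] by (simp add: row_def)
    then show ?thesis
      by (simp add: vec_eq_iff column_def mult.commute)
  qed
  then have "columns M \<subseteq> vec.span ((\<lambda>b. \<chi> i. c i b) ` B)"
    by (auto simp: columns_def intro: vec.span_sum[OF vec.span_scale[OF vec.span_base]])
  then have "vec.dim (columns M) \<le> card ((\<lambda>b. \<chi> i. c i b) ` B)"
    using fin by (intro vec.dim_le_card) auto
  also have "\<dots> \<le> vec.dim (rows M)"
    using card_image_le[OF fin] B(4) by metis
  finally show ?thesis .
qed

lemma dim_columns_eq_dim_rows:
  fixes M :: "'a::field ^ 'n ^ 'm"
  shows "vec.dim (columns M) = vec.dim (rows M)"
proof (rule antisym[OF dim_columns_le_dim_rows])
  show "vec.dim (rows M) \<le> vec.dim (columns M)"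
    using dim_columns_le_dim_rows[of "transpose M"] by (simp add: columns_transpose rows_transpose)
qed

lemma matroid_rank_column_indep:
  fixes A :: "'a::field ^ 'n ^ 'm"
  shows "matroid_rank (column_indep A) S = vec.dim ((\<lambda>j. column j A) ` S)"
proof -
  let ?c = "\<lambda>j. column j A"
  have "Max (card ` {J \<in> column_indep A. J \<subseteq> S}) = vec.dim (?c ` S)"
  proof (rule Max_eqI)
    show "finite (card ` {J \<in> column_indep A. J \<subseteq> S})"
      by auto
    show "k \<le> vec.dim (?c ` S)" if k: "k \<in> card ` {J \<in> column_indep A. J \<subseteq> S}" for k
    proof -
      obtain J where "J \<in> column_indep A" "J \<subseteq> S" "k = card J"
        using k by auto
      then show ?thesis
        using vec.independent_card_le_dim[of "?c ` J" "?c ` S"]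
        by (auto simp: column_indep_def card_image)
    qed
    obtain B where B: "B \<subseteq> ?c ` S" "vec.independent B" "card B = vec.dim (?c ` S)"
      using vec.basis_exists[of "?c ` S"] by metis
    \<comment> \<open>One index is picked per basis vector; this supplies the injectivity that
      \<open>column_indep\<close> demands when columns are repeated.\<close>
    obtain J where J: "J \<subseteq> S" "inj_on ?c J" "B = ?c ` J"
      using B(1) by (metis subset_image_inj)
    then show "vec.dim (?c ` S) \<in> card ` {J \<in> column_indep A. J \<subseteq> S}"
      using B by (auto simp: column_indep_def card_image intro!: image_eqI[of _ _ J])
  qed
  then show ?thesis
    by (simp add: matroid_rank_def)
qed

lemma dim_image_span:
  fixes f :: "'a::field ^ 'n \<Rightarrow> 'a ^ 'm"
  assumes "Vector_Spaces.linear (*s) (*s) f"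
  shows "vec.dim (f ` vec.span S) = vec.dim (f ` S)"
  by (metis assms vec.dim_span vec.linear_span_image)

text \<open>Row rank equals column rank, applied to \<open>A\<close> with the columns outside
  \<open>S\<close> set to zero. The right-hand side depends on the row space alone, so
  row-equivalent matrices share their rank function.\<close>

lemma matroid_rank_row_space:
  fixes A :: "'a::field ^ 'n ^ 'm"
  shows "matroid_rank (column_indep A) S = vec.dim (restrict_to S ` vec.span (rows A))"
proof -
  let ?c = "\<lambda>j. column j A"
  define M where "M = (\<chi> i. restrict_to S (row i A))"
  have col: "column j M = (if j \<in> S then column j A else 0)" for j
    by (simp add: M_def column_def row_def vec_eq_iff)
  have "columns M \<subseteq> vec.span (?c ` S)"
    by (auto simp: columns_def col vec.span_zero intro: vec.span_base)
  moreover have "?c ` S \<subseteq> columns M"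
    by (auto simp: columns_def col)
  ultimately have "vec.dim (columns M) = vec.dim (?c ` S)"
    by (intro antisym vec.dim_mono) (auto intro: vec.span_base)
  moreover have "row i M = restrict_to S (row i A)" for i
    by (simp add: M_def row_def vec_eq_iff)
  then have "rows M = restrict_to S ` rows A"
    by (auto simp: rows_def)
  ultimately show ?thesis
    by (simp add: matroid_rank_column_indep dim_columns_eq_dim_rows dim_image_span linear_restrict_to)
qed

text \<open>A basis \<open>B\<close> of the kernel and preimages \<open>C'\<close> of a basis of the
  image together span \<open>Q\<close>: subtracting from \<open>x\<close> an element of the span of
  \<open>C'\<close> with the same image leaves a kernel element.\<close>

lemma dim_le_dim_kernel_plus_image:
  fixes f :: "'a::field ^ 'n \<Rightarrow> 'a ^ 'm"
  assumes f: "Vector_Spaces.linear (*s) (*s) f" and Q: "vec.subspace Q"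
  shows "vec.dim Q \<le> vec.dim {x \<in> Q. f x = 0} + vec.dim (f ` Q)"
proof -
  let ?K = "{x \<in> Q. f x = 0}"
  obtain B where B: "B \<subseteq> ?K" "vec.independent B" "?K \<subseteq> vec.span B" "card B = vec.dim ?K"
    using vec.basis_exists by blast
  obtain C where C: "C \<subseteq> f ` Q" "vec.independent C" "f ` Q \<subseteq> vec.span C" "card C = vec.dim (f ` Q)"
    using vec.basis_exists by blast
  obtain C' where C': "C' \<subseteq> Q" "inj_on f C'" "C = f ` C'"
    using C(1) by (metis subset_image_inj)
  have fin: "finite B" "finite C'"
    using vec.finiteI_independent[OF B(2)] vec.finiteI_independent[OF C(2)] C'(2,3)
    by (auto dest: finite_imageD)
  have "x \<in> vec.span (B \<union> C')" if x: "x \<in> Q" for x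
  proof -
    have "f x \<in> f ` vec.span C'"
      using C(3) C'(3) x vec.linear_span_image[OF f] by auto
    then obtain z where z: "z \<in> vec.span C'" "f x = f z"
      by auto
    have "z \<in> Q"
      using z(1) vec.span_minimal[OF C'(1) Q] by auto
    then have "x - z \<in> ?K"
      using x z(2) vec.subspace_diff[OF Q] vec.linear_diff[OF f] by auto
    then have "x - z \<in> vec.span (B \<union> C')"
      using B(3) vec.span_mono[of B "B \<union> C'"] by auto
    moreover have "z \<in> vec.span (B \<union> C')"
      using z(1) vec.span_mono[of C' "B \<union> C'"] by auto
    ultimately show ?thesis
      using vec.span_add by fastforce
  qed
  then have "vec.dim Q \<le> card (B \<union> C')"
    using fin by (intro vec.dim_le_card) auto
  also have "\<dots> \<le> card B + card C'"
    by (rule card_Un_le)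
  also have "card C' = card C"
    using C' by (simp add: card_image)
  finally show ?thesis
    using B(4) C(4) by simp
qed

text \<open>The coefficients are indexed by \<open>I\<close> even when \<open>f\<close> repeats
  values, as rows of a matrix may: one index represents each value and the others get coefficient
  0.\<close>

lemma in_span_image_finite:
  fixes f :: "'i \<Rightarrow> 'a::field ^ 'n"
  assumes "finite I" "x \<in> vec.span (f ` I)"
  obtains u where "x = (\<Sum>i\<in>I. u i *s f i)"
proof -
  obtain J where J: "J \<subseteq> I" "inj_on f J" "f ` I = f ` J"
    by (metis subset_image_inj order_refl)
  have "finite (f ` J)"
    using assms(1) J(3) by (metis finite_imageI)
  then obtain w where "x = (\<Sum>v\<in>f ` J. w v *s v)"
    using assms(2) J(3) by (auto simp: vec.span_finite)
  also have "\<dots> = (\<Sum>i\<in>J. w (f i) *s f i)"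
    using J(2) by (simp add: sum.reindex)
  also have "\<dots> = (\<Sum>i\<in>I. (if i \<in> J then w (f i) else 0) *s f i)"
    using J(1) assms(1) by (intro sum.mono_neutral_cong_left) auto
  finally show ?thesis
    by (rule that)
qed

section \<open>Row spaces, row bases and independent vectors with prescribed supports\<close>

lemma rows_eq_image: "rows A = (\<lambda>i. row i A) ` UNIV"
  by (auto simp: rows_def)

lemma row_lambda [simp]: "row i (\<chi> k. f k) = f i"
  by (simp add: row_def vec_eq_iff)

lemma matrix_eq_rows: "A = B \<longleftrightarrow> (\<forall>i. row i A = row i B)"
  by (simp add: row_def vec_eq_iff)

lemma row_in_span_rows: "row i A \<in> vec.span (rows A)"
  by (auto simp: rows_def intro: vec.span_base)

lemma span_rows_subset_iff:
  "vec.span (rows A) \<subseteq> vec.span (rows B) \<longleftrightarrow> (\<forall>i. row i A \<in> vec.span (rows B))"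
proof
  assume "vec.span (rows A) \<subseteq> vec.span (rows B)"
  then show "\<forall>i. row i A \<in> vec.span (rows B)"
    using row_in_span_rows by blast
next
  assume "\<forall>i. row i A \<in> vec.span (rows B)"
  then show "vec.span (rows A) \<subseteq> vec.span (rows B)"
    by (intro vec.span_minimal) (auto simp: rows_def)
qed

lemma matroid_rank_UNIV_eq_dim_rows:
  fixes A :: "'a::field ^ 'n ^ 'm"
  shows "matroid_rank (column_indep A) UNIV = vec.dim (rows A)"
proof -
  have "restrict_to UNIV = (id :: 'a ^ 'n \<Rightarrow> _)"
    by (simp add: fun_eq_iff vec_eq_iff)
  then show ?thesis
    by (simp add: matroid_rank_row_space)
qed

text \<open>The basis is given by row indices instead of vectors, because the indices are the
  vertices of the dual graph.\<close>

lemma row_basis: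
  fixes A :: "'a::field ^ 'n ^ 'm"
  obtains I where "inj_on (\<lambda>i. row i A) I" "vec.independent ((\<lambda>i. row i A) ` I)"
    "vec.span (rows A) = vec.span ((\<lambda>i. row i A) ` I)" "card I = vec.dim (rows A)"
proof -
  obtain B where B: "B \<subseteq> rows A" "vec.independent B" "rows A \<subseteq> vec.span B" "card B = vec.dim (rows A)"
    using vec.basis_exists[of "rows A"] by metis
  obtain I where I: "inj_on (\<lambda>i. row i A) I" "B = (\<lambda>i. row i A) ` I"
    using B(1) unfolding rows_eq_image by (metis subset_image_inj)
  have "vec.span (rows A) = vec.span B"
    using B(1,3) by (intro antisym vec.span_minimal vec.span_mono) auto
  then show ?thesis
    using that[of I] I B by (simp add: card_image)
qed

text \<open>The greedy choice from the leaves upwards. Here \<open>(e, e') \<in> s\<close> says that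
  the edge \<open>e'\<close> lies strictly below \<open>e\<close>, and \<open>Q\<close> will be the
  row space. The dimension bound leaves room for a new vector at \<open>e\<close> beyond the vectors
  chosen below \<open>e\<close>; vectors of incomparable edges vanish on \<open>X e\<close> and
  cannot interfere.\<close>

lemma independent_supported_family:
  fixes Q :: "('a::field ^ 'n) set" and s :: "'e rel" and X :: "'e \<Rightarrow> 'n set"
  assumes "finite E" and s: "trans s" "acyclic s"
    and sub: "\<And>e e'. e \<in> E \<Longrightarrow> e' \<in> E \<Longrightarrow> (e, e') \<in> s \<Longrightarrow> X e' \<subseteq> X e"
    and disj: "\<And>e e'. e \<in> E \<Longrightarrow> e' \<in> E \<Longrightarrow> e \<noteq> e' \<Longrightarrow> (e, e') \<notin> s \<Longrightarrow> (e', e) \<notin> s \<Longrightarrow> X e \<inter> X e' = {}"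
    and dim: "\<And>e. e \<in> E \<Longrightarrow> card {e' \<in> E. (e, e') \<in> s} < vec.dim {x \<in> Q. restrict_to (X e) x = x}"
  obtains y where "inj_on y E" "vec.independent (y ` E)" "\<And>e. e \<in> E \<Longrightarrow> y e \<in> Q"
    "\<And>e. e \<in> E \<Longrightarrow> restrict_to (X e) (y e) = y e"
proof -
  have "\<exists>y. inj_on y D \<and> vec.independent (y ` D) \<and> (\<forall>e\<in>D. y e \<in> Q \<and> restrict_to (X e) (y e) = y e)"
    if "D \<subseteq> E" "\<And>e e'. e \<in> D \<Longrightarrow> e' \<in> E \<Longrightarrow> (e, e') \<in> s \<Longrightarrow> e' \<in> D" for D
    using finite_subset[OF that(1) assms(1)] that
  proof (induction rule: finite_psubset_induct)
    case (psubset D)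
    show ?case
    proof (cases "D = {}")
      case True
      then show ?thesis
        by (auto simp: vec.independent_empty)
    next
      case False
      \<comment> \<open>\<open>e\<close> is an element of \<open>D\<close> with nothing of
        \<open>D\<close> above it. Removing it leaves a set closed under going down, and each
        remaining element is below \<open>e\<close> or incomparable with it.\<close>
      have "wf (Restr s D)"
        using psubset.hyps s(2) by (intro finite_acyclic_wf) (auto intro: acyclic_subset)
      then obtain e where e: "e \<in> D" "\<And>a. a \<in> D \<Longrightarrow> (a, e) \<notin> s"
        using False unfolding wf_eq_minimal by (metis IntI SigmaI ex_in_conv)
      let ?D = "D - {e}"
      let ?B = "{e' \<in> E. (e, e') \<in> s}"
      have "e \<in> E"
        using e psubset.prems by auto
      have "?D \<subset> D" "?D \<subseteq> E"
        using e psubset.prems by auto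
      moreover have "e' \<in> ?D" if "a \<in> ?D" "e' \<in> E" "(a, e') \<in> s" for a e'
        using that e psubset.prems(2) by auto
      ultimately obtain y where y: "inj_on y ?D" "vec.independent (y ` ?D)"
        "\<And>a. a \<in> ?D \<Longrightarrow> y a \<in> Q" "\<And>a. a \<in> ?D \<Longrightarrow> restrict_to (X a) (y a) = y a"
        using psubset.IH[of ?D] by metis
      have "(e, e) \<notin> s"
        using e by auto
      then have B: "?B \<subseteq> ?D"
        using e psubset.prems(2) by auto
      \<comment> \<open>Restriction to \<open>X e\<close> kills the vectors chosen outside \<open>?B\<close> and fixes those chosen on it.\<close>
      have rest: "restrict_to (X e) (y a) \<in> vec.span (y ` ?B)" if a: "a \<in> ?D" for a
      proof (cases "a \<in> ?B")
        case True
        then have "X a \<subseteq> X e"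
          using sub \<open>e \<in> E\<close> by blast
        then have "restrict_to (X e) (y a) = y a"
          using y(4)[OF a] by (auto simp: vec_eq_iff split: if_splits)
        then show ?thesis
          using True by (auto intro: vec.span_base)
      next
        case False
        then have "X e \<inter> X a = {}"
          using disj[OF \<open>e \<in> E\<close>, of a] a e(2) psubset.prems(1) by auto
        then have "restrict_to (X e) (y a) = 0"
          using y(4)[OF a] by (auto simp: vec_eq_iff) (metis disjoint_iff)
        then show ?thesis
          by (simp add: vec.span_zero)
      qed
      \<comment> \<open>Otherwise each vector of \<open>Q\<close> supported in \<open>X e\<close>,
        being its own restriction, would lie in the span of the vectors chosen on \<open>?B\<close>,
        and the dimension would be at most \<open>card ?B\<close>.\<close>
      have "\<exists>x\<in>Q. restrict_to (X e) x = x \<and> x \<notin> vec.span (y ` ?D)"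
      proof (rule ccontr)
        assume none: "\<not> ?thesis"
        have "{x \<in> Q. restrict_to (X e) x = x} \<subseteq> vec.span (y ` ?B)"
        proof
          fix x assume x: "x \<in> {x \<in> Q. restrict_to (X e) x = x}"
          then have "x \<in> restrict_to (X e) ` vec.span (y ` ?D)"
            using none by (auto intro: image_eqI[of _ _ x])
          also have "\<dots> = vec.span (restrict_to (X e) ` y ` ?D)"
            by (rule vec.linear_span_image[OF linear_restrict_to, symmetric])
          also have "\<dots> \<subseteq> vec.span (y ` ?B)"
            using rest by (intro vec.span_minimal vec.subspace_span) auto
          finally show "x \<in> vec.span (y ` ?B)" .
        qed
        then have "vec.dim {x \<in> Q. restrict_to (X e) x = x} \<le> card (y ` ?B)"
          using assms(1) by (intro vec.dim_le_card) auto
        also have "\<dots> \<le> card ?B"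
          using assms(1) by (intro card_image_le) auto
        finally show False
          using dim[OF \<open>e \<in> E\<close>] by simp
      qed
      then obtain x where x: "x \<in> Q" "restrict_to (X e) x = x" "x \<notin> vec.span (y ` ?D)"
        by blast
      let ?y = "y(e := x)"
      have im: "?y ` D = insert x (y ` ?D)"
        using e(1) by auto
      have "x \<notin> y ` ?D"
        using x(3) by (auto intro: vec.span_base)
      then have "inj_on ?y D"
        using y(1) by (auto simp: inj_on_def)
      moreover have "vec.independent (?y ` D)"
        unfolding im using x(3) y(2) by (rule vec.independent_insertI)
      moreover have "\<forall>a\<in>D. ?y a \<in> Q \<and> restrict_to (X a) (?y a) = ?y a"
        using x y by auto
      ultimately show ?thesis
        by blast
    qed
  qed
  from this[of E] that show ?thesis
    by auto
qed

section \<open>Row equivalence\<close>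

text \<open>Each operation can be undone, so the rows of either matrix are combinations of the rows
  of the other.\<close>

lemma elementary_row_operation_span_rows:
  assumes "elementary_row_operation A B"
  shows "vec.span (rows B) = vec.span (rows A)"
  using assms
proof cases
  case (swap_rows i j)
  have "row k A = row (Transposition.transpose i j k) B" for k
    by (simp add: swap_rows)
  then have "row k A \<in> vec.span (rows B)" for k
    by (simp add: row_in_span_rows)
  moreover have "row k B \<in> vec.span (rows A)" for k
    by (simp add: swap_rows row_in_span_rows)
  ultimately show ?thesis
    by (simp add: antisym span_rows_subset_iff)
next
  case (scale_row c i)
  have "row k A = (if k = i then inverse c *s row k B else row k B)" for k
    using scale_row by simp
  then have "row k A \<in> vec.span (rows B)" for k
    by (simp add: row_in_span_rows vec.span_scale)
  moreover have "row k B \<in> vec.span (rows A)" for k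
    by (simp add: scale_row row_in_span_rows vec.span_scale)
  ultimately show ?thesis
    by (simp add: antisym span_rows_subset_iff)
next
  case (add_row i j c)
  have "row k A = (if k = i then row k B - c *s row j B else row k B)" for k
    using add_row by simp
  then have "row k A \<in> vec.span (rows B)" for k
    by (simp add: row_in_span_rows vec.span_scale vec.span_diff)
  moreover have "row k B \<in> vec.span (rows A)" for k
    by (simp add: add_row row_in_span_rows vec.span_scale vec.span_add)
  ultimately show ?thesis
    by (simp add: antisym span_rows_subset_iff)
qed

lemma row_equivalent_span_rows:
  assumes "row_equivalent A B"
  shows "vec.span (rows B) = vec.span (rows A)"
  using assms unfolding row_equivalent_def
  by (induction rule: rtranclp_induct) (auto dest: elementary_row_operation_span_rows)

lemma row_equivalent_refl [simp]: "row_equivalent A A"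
  by (simp add: row_equivalent_def)

lemma row_equivalent_trans: "row_equivalent A B \<Longrightarrow> row_equivalent B C \<Longrightarrow> row_equivalent A C"
  by (simp add: row_equivalent_def)

lemma row_equivalent_step: "row_equivalent A B \<Longrightarrow> elementary_row_operation B C \<Longrightarrow> row_equivalent A C"
  by (simp add: row_equivalent_def)

text \<open>Scale row \<open>k\<close> by \<open>u k\<close>, then add the multiples of the other
  rows one at a time; those rows stay unchanged meanwhile.\<close>

lemma row_equivalent_combination:
  fixes A :: "'a::field ^ 'n ^ 'm"
  assumes "u k \<noteq> 0"
  shows "row_equivalent A (\<chi> i. if i = k then \<Sum>l\<in>UNIV. u l *s row l A else row i A)"
proof -
  have "row_equivalent A (\<chi> i. if i = k then u k *s row k A + (\<Sum>l\<in>S. u l *s row l A) else row i A)"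
    if "finite S" "k \<notin> S" for S
    using that
  proof induction
    case empty
    have "elementary_row_operation A (\<chi> i. if i = k then u k *s row k A else row i A)"
      using assms by (rule elementary_row_operation.scale_row)
    then have "row_equivalent A (\<chi> i. if i = k then u k *s row k A else row i A)"
      by (rule row_equivalent_step[OF row_equivalent_refl])
    then show ?case
      by (simp cong: if_cong)
  next
    case (insert x S)
    let ?B = "\<chi> i. if i = k then u k *s row k A + (\<Sum>l\<in>S. u l *s row l A) else row i A"
    have "elementary_row_operation ?B (\<chi> i. if i = k then row k ?B + u x *s row x ?B else row i ?B)"
      using insert.prems by (intro elementary_row_operation.add_row) auto
    moreover have "(\<chi> i. if i = k then row k ?B + u x *s row x ?B else row i ?B) =
        (\<chi> i. if i = k then u k *s row k A + (\<Sum>l\<in>insert x S. u l *s row l A) else row i A)"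
      using insert by (auto simp: matrix_eq_rows algebra_simps)
    ultimately show ?case
      using insert row_equivalent_step by fastforce
  qed
  from this[of "UNIV - {k}"] show ?thesis
    by (simp add: sum.remove[of UNIV k] cong: if_cong)
qed

text \<open>Steinitz exchange. Row \<open>x\<close> of \<open>B\<close> is a combination of rows of
  \<open>C\<close> that must involve some row \<open>y\<close> outside \<open>K\<close>, so row
  \<open>y\<close> can be traded for it without touching the rows in \<open>K\<close>.\<close>

lemma row_equivalent_extend_agreement:
  fixes B C :: "'a::field ^ 'n ^ 'm"
  assumes agree: "\<And>k. k \<in> K \<Longrightarrow> row k C = row k B"
    and x: "row x B \<in> vec.span (rows C)" "row x B \<notin> vec.span ((\<lambda>i. row i B) ` K)"
  obtains C' where "row_equivalent C C'" "\<And>k. k \<in> insert x K \<Longrightarrow> row k C' = row k B"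
proof -
  have "x \<notin> K"
    using x(2) by (auto intro: vec.span_base)
  obtain u where u: "row x B = (\<Sum>l\<in>UNIV. u l *s row l C)"
    using x(1) in_span_image_finite[of UNIV "row x B" "\<lambda>i. row i C"] by (auto simp: rows_eq_image)
  have "\<exists>y. y \<notin> K \<and> u y \<noteq> 0"
  proof (rule ccontr)
    assume "\<not> ?thesis"
    then have "row x B = (\<Sum>l\<in>K. u l *s row l B)"
      unfolding u by (intro sum.mono_neutral_cong_right) (auto simp: agree)
    then show False
      using x(2) by (auto intro: vec.span_sum vec.span_scale vec.span_base)
  qed
  then obtain y where y: "y \<notin> K" "u y \<noteq> 0"
    by blast
  let ?t = "Transposition.transpose x y"
  define D where "D = (\<chi> k. row (?t k) C)"
  \<comment> \<open>After the swap, position \<open>x\<close> carries the coefficient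
    \<open>u y\<close>, which is non-zero, so row \<open>x\<close> may be replaced by the whole
    combination. The case \<open>y = x\<close> is included, with a trivial swap.\<close>
  let ?E = "\<chi> i. if i = x then \<Sum>l\<in>UNIV. u (?t l) *s row l D else row i D"
  have "row_equivalent C D"
    unfolding D_def by (rule row_equivalent_step[OF row_equivalent_refl elementary_row_operation.swap_rows])
  moreover have "row_equivalent D ?E"
    using y by (intro row_equivalent_combination[where u = "\<lambda>l. u (?t l)"]) simp
  moreover have "row k ?E = row k B" if "k \<in> insert x K" for k
  proof (cases "k = x")
    case True
    have "(\<Sum>l\<in>UNIV. u (?t l) *s row (?t l) C) = (\<Sum>l\<in>UNIV. u l *s row l C)"
      by (rule sum.reindex_bij_witness[of _ ?t ?t]) auto
    then show ?thesis
      using True u by (simp add: D_def)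
  next
    case False
    then have "k \<in> K"
      using that by simp
    then have "k \<noteq> y"
      using y by auto
    with False \<open>k \<in> K\<close> show ?thesis
      by (simp add: D_def transpose_def agree)
  qed
  ultimately show ?thesis
    using that row_equivalent_trans by blast
qed

text \<open>Two stages: exchange puts the basis rows of \<open>B\<close> into the positions
  \<open>I\<close> one by one; afterwards they span the common row space, so every other row can be
  cleared to zero.\<close>

lemma row_equivalent_of_span_rows_eq:
  fixes A B :: "'a::field ^ 'n ^ 'm"
  assumes span: "vec.span (rows A) = vec.span (rows B)"
    and inj: "inj_on (\<lambda>i. row i B) I" and indep: "vec.independent ((\<lambda>i. row i B) ` I)"
    and zero: "\<And>i. i \<notin> I \<Longrightarrow> row i B = 0"
  shows "row_equivalent A B"
proof -
  let ?b = "\<lambda>i. row i B"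
  have "K \<subseteq> I \<Longrightarrow> \<exists>C. row_equivalent A C \<and> (\<forall>k\<in>K. row k C = ?b k)" if "finite K" for K
    using that
  proof induction
    case empty
    then show ?case
      using row_equivalent_refl by blast
  next
    case (insert x K)
    then obtain C where C: "row_equivalent A C" "\<And>k. k \<in> K \<Longrightarrow> row k C = ?b k"
      by auto
    have "?b x \<in> vec.span (rows C)"
      using row_equivalent_span_rows[OF C(1)] span by (simp add: row_in_span_rows)
    moreover have "?b x \<notin> vec.span (?b ` K)"
    proof
      assume *: "?b x \<in> vec.span (?b ` K)"
      have "?b ` K \<subseteq> ?b ` I - {?b x}"
        using insert inj by (auto simp: inj_on_def)
      then have "?b x \<in> vec.span (?b ` I - {?b x})"
        using * vec.span_mono by blast
      then show False
        using indep insert.prems by (auto simp: vec.dependent_def)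
    qed
    ultimately obtain C' where "row_equivalent C C'" "\<And>k. k \<in> insert x K \<Longrightarrow> row k C' = ?b k"
      using row_equivalent_extend_agreement[of K C B x] C(2) by metis
    then show ?case
      using row_equivalent_trans[OF C(1)] by blast
  qed
  then obtain C0 where C0: "row_equivalent A C0" "\<And>k. k \<in> I \<Longrightarrow> row k C0 = ?b k"
    by (meson finite order_refl)
  have "Z \<subseteq> - I \<Longrightarrow> \<exists>C. row_equivalent A C \<and> (\<forall>k\<in>I \<union> Z. row k C = ?b k)" if "finite Z" for Z
    using that
  proof induction
    case empty
    then show ?case
      using C0 by auto
  next
    case (insert x Z)
    then obtain C where C: "row_equivalent A C" "\<And>k. k \<in> I \<union> Z \<Longrightarrow> row k C = ?b k"
      by auto
    have "x \<notin> I"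
      using insert.prems by auto
    have "rows B \<subseteq> vec.span (?b ` I)"
    proof
      fix v assume "v \<in> rows B"
      then obtain i where "v = ?b i"
        by (auto simp: rows_def)
      then show "v \<in> vec.span (?b ` I)"
        using zero[of i] by (cases "i \<in> I") (auto simp: vec.span_zero intro: vec.span_base)
    qed
    then have "vec.span (rows C) \<subseteq> vec.span (?b ` I)"
      using row_equivalent_span_rows[OF C(1)] span by (simp add: vec.span_minimal)
    then have "row x C \<in> vec.span (?b ` I)"
      using row_in_span_rows[of x C] by blast
    then obtain w where w: "row x C = (\<Sum>i\<in>I. w i *s ?b i)"
      using in_span_image_finite[OF finite] by metis
    \<comment> \<open>This combination subtracts from row \<open>x\<close> its expansion in the
      basis rows. The coefficient 1 at \<open>x\<close> makes the replacement a legal sequence of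
      row operations.\<close>
    define u where "u i = (if i \<in> I then - w i else if i = x then 1 else 0)" for i
    let ?C' = "\<chi> i. if i = x then \<Sum>l\<in>UNIV. u l *s row l C else row i C"
    have "row_equivalent C ?C'"
      using \<open>x \<notin> I\<close> by (intro row_equivalent_combination) (simp add: u_def)
    moreover have "row k ?C' = ?b k" if "k \<in> I \<union> insert x Z" for k
    proof (cases "k = x")
      case True
      have "(\<Sum>l\<in>UNIV. u l *s row l C) = (\<Sum>l\<in>insert x I. u l *s row l C)"
        by (intro sum.mono_neutral_right) (auto simp: u_def)
      also have "\<dots> = row x C + (\<Sum>l\<in>I. u l *s row l C)"
        using \<open>x \<notin> I\<close> by (simp add: u_def)
      also have "(\<Sum>l\<in>I. u l *s row l C) = (\<Sum>l\<in>I. - (w l *s ?b l))"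
        by (intro sum.cong) (auto simp: u_def C(2) vec_eq_iff)
      finally show ?thesis
        using True w zero[OF \<open>x \<notin> I\<close>] by (simp add: sum_negf)
    next
      case False
      then show ?thesis
        using that C(2) by auto
    qed
    ultimately show ?case
      using row_equivalent_trans[OF C(1)] by blast
  qed
  from this[of "- I"] obtain C where "row_equivalent A C" "\<And>k. row k C = ?b k"
    by auto
  then show ?thesis
    by (metis matrix_eq_rows)
qed

lemma row_equivalent_matroid_rank:
  fixes A A' :: "'a::field ^ 'n ^ 'm"
  assumes "row_equivalent A A'"
  shows "matroid_rank (column_indep A') = matroid_rank (column_indep A)"
  by (simp add: fun_eq_iff matroid_rank_row_space row_equivalent_span_rows[OF assms])

section \<open>Rooted forests and tree-depth\<close>

lemma rooted_forest_finite: "rooted_forest F \<Longrightarrow> pair_fin_digraph F"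
  by (simp add: rooted_forest_def)

text \<open>With at most one incoming arc per vertex, an arc is determined by its head; below, arcs
  are compared and counted through \<open>snd\<close>.\<close>

lemma rooted_forest_inj_snd:
  assumes "rooted_forest F"
  shows "inj_on snd (parcs F)"
proof (rule inj_onI)
  fix e e' assume e: "e \<in> parcs F" "e' \<in> parcs F" "snd e = snd e'"
  interpret pair_fin_digraph F
    using assms by (rule rooted_forest_finite)
  have "card (in_arcs (with_proj F) (snd e)) \<le> Suc 0"
    using assms e arc_snd_in_verts by (auto simp: rooted_forest_def in_degree_def)
  moreover have "finite (in_arcs (with_proj F) (snd e))"
    by (rule finite_in_arcs)
  ultimately show "e = e'"
    using e by (auto simp: card_le_Suc0_iff_eq)
qed

lemma rooted_forest_unique_parent:
  assumes "rooted_forest F" "(u, w) \<in> parcs F" "(v, w) \<in> parcs F"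
  shows "u = v"
  using inj_onD[OF rooted_forest_inj_snd[OF assms(1)] _ assms(2,3)] by simp

lemma roots_iff:
  assumes "pair_fin_digraph F"
  shows "v \<in> roots F \<longleftrightarrow> v \<in> pverts F \<and> (\<forall>u. (u, v) \<notin> parcs F)"
proof -
  interpret pair_fin_digraph F
    by fact
  have "in_degree (with_proj F) v = 0 \<longleftrightarrow> (\<forall>u. (u, v) \<notin> parcs F)"
    using finite_in_arcs[of v] by (auto simp: in_degree_def in_arcs_def)
  then show ?thesis
    by (simp add: roots_def)
qed

lemma leaves_iff:
  assumes "pair_fin_digraph F"
  shows "v \<in> leaves F \<longleftrightarrow> v \<in> pverts F \<and> (\<forall>u. (v, u) \<notin> parcs F)"
proof -
  interpret pair_fin_digraph F
    by fact
  have "out_degree (with_proj F) v = 0 \<longleftrightarrow> (\<forall>u. (v, u) \<notin> parcs F)"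
    using finite_out_arcs[of v] by (auto simp: out_degree_def out_arcs_def)
  then show ?thesis
    by (simp add: leaves_def)
qed

text \<open>Induction along the path from \<open>u\<close>: an ancestor of \<open>z\<close> other
  than \<open>z\<close> itself is an ancestor of the unique parent of \<open>z\<close>.\<close>

lemma rooted_forest_ancestors_chain:
  assumes "rooted_forest F" "(u, w) \<in> (parcs F)\<^sup>*" "(v, w) \<in> (parcs F)\<^sup>*"
  shows "(u, v) \<in> (parcs F)\<^sup>* \<or> (v, u) \<in> (parcs F)\<^sup>*"
  using assms(2,3)
proof (induction arbitrary: v rule: rtrancl_induct)
  case base
  then show ?case
    by simp
next
  case (step y z)
  show ?case
  proof (cases "v = z")
    case True
    then show ?thesis
      using step.hyps by (simp add: rtrancl_into_rtrancl)
  next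
    case False
    then obtain x where "(v, x) \<in> (parcs F)\<^sup>*" "(x, z) \<in> parcs F"
      using step.prems by (auto elim: rtranclE)
    then show ?thesis
      using step rooted_forest_unique_parent[OF assms(1)] by blast
  qed
qed

text \<open>Followed backwards, a walk has no choice, since parents are unique and it ends only at
  the root. Hence arc sets and lengths of root paths can be replaced by ancestor sets.\<close>

lemma arcs_of_walk_from_root:
  assumes F: "rooted_forest F" and r: "r \<in> roots F" and p: "pre_digraph.awalk (with_proj F) r p v"
  shows "set p = {e \<in> parcs F. (snd e, v) \<in> (parcs F)\<^sup>*}"
    and "{w. (w, v) \<in> (parcs F)\<^sup>*} = insert r (snd ` set p)"
    and "length p = card {e \<in> parcs F. (snd e, v) \<in> (parcs F)\<^sup>*}"
    and "card {w. (w, v) \<in> (parcs F)\<^sup>*} = Suc (length p)"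
proof -
  interpret pair_fin_digraph F
    using F by (rule rooted_forest_finite)
  have no_parent: "(u, r) \<notin> parcs F" for u
    using r roots_iff[OF rooted_forest_finite[OF F]] by auto
  have "set p = {e \<in> parcs F. (snd e, v) \<in> (parcs F)\<^sup>*} \<and>
      {w. (w, v) \<in> (parcs F)\<^sup>*} = insert r (snd ` set p) \<and> distinct p"
    using p
  proof (induction p arbitrary: v rule: rev_induct)
    case Nil
    then have "v = r"
      by (simp add: awalk_Nil_iff)
    then show ?case
      using no_parent by (auto elim: rtranclE)
  next
    case (snoc e p)
    then obtain u where u: "e = (u, v)" "e \<in> parcs F" "awalk r p u"
      by (cases e) (auto simp: awalk_simps)
    note IH = snoc.IH[OF u(3)]
    have step: "(w, v) \<in> (parcs F)\<^sup>* \<longleftrightarrow> w = v \<or> (w, u) \<in> (parcs F)\<^sup>*" for w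
      using u(1,2) by (metis rooted_forest_unique_parent[OF F] rtranclE rtrancl_into_rtrancl rtrancl.rtrancl_refl)
    have "(v, u) \<notin> (parcs F)\<^sup>*"
      using F u by (auto simp: rooted_forest_def acyclic_def dest: rtrancl_into_trancl1)
    then have "e \<notin> set p"
      using IH u(1) by simp
    moreover have "e' \<in> parcs F \<and> (snd e', v) \<in> (parcs F)\<^sup>* \<longleftrightarrow>
        e' = e \<or> e' \<in> parcs F \<and> (snd e', u) \<in> (parcs F)\<^sup>*" for e'
      using u(1,2) inj_onD[OF rooted_forest_inj_snd[OF F], of e' e] step[of "snd e'"] by auto
    then have "{e' \<in> parcs F. (snd e', v) \<in> (parcs F)\<^sup>*} = insert e {e' \<in> parcs F. (snd e', u) \<in> (parcs F)\<^sup>*}"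
      by blast
    moreover have "{w. (w, v) \<in> (parcs F)\<^sup>*} = insert v {w. (w, u) \<in> (parcs F)\<^sup>*}"
      using step by blast
    ultimately show ?case
      using IH u(1) by (simp add: insert_commute)
  qed
  then have set: "set p = {e \<in> parcs F. (snd e, v) \<in> (parcs F)\<^sup>*}"
    and verts: "{w. (w, v) \<in> (parcs F)\<^sup>*} = insert r (snd ` set p)" and dist: "distinct p"
    by auto
  show "set p = {e \<in> parcs F. (snd e, v) \<in> (parcs F)\<^sup>*}" "{w. (w, v) \<in> (parcs F)\<^sup>*} = insert r (snd ` set p)"
    by (fact set verts)+
  show "length p = card {e \<in> parcs F. (snd e, v) \<in> (parcs F)\<^sup>*}"
    using dist by (simp add: set[symmetric] distinct_card)
  have "set p \<subseteq> parcs F"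
    unfolding set by auto
  then have "card (snd ` set p) = length p"
    using dist inj_on_subset[OF rooted_forest_inj_snd[OF F]] by (simp add: card_image distinct_card)
  moreover have "r \<notin> snd ` set p"
    using no_parent \<open>set p \<subseteq> parcs F\<close> by auto
  ultimately show "card {w. (w, v) \<in> (parcs F)\<^sup>*} = Suc (length p)"
    unfolding verts by simp
qed

lemma finite_ancestors:
  assumes F: "rooted_forest F" and v: "v \<in> pverts F"
  shows "finite {w. (w, v) \<in> (parcs F)\<^sup>*}"
proof -
  interpret pair_fin_digraph F
    using F by (rule rooted_forest_finite)
  have "w \<in> pverts F" if "(w, v) \<in> (parcs F)\<^sup>*" for w
    using that v wellformed'(1) by (auto elim: converse_rtranclE)
  then have "{w. (w, v) \<in> (parcs F)\<^sup>*} \<subseteq> pverts F"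
    by blast
  then show ?thesis
    using pair_finite_verts by (rule finite_subset)
qed

lemma ex_root_above:
  assumes F: "rooted_forest F" and v: "v \<in> pverts F"
  obtains r where "r \<in> roots F" "(r, v) \<in> (parcs F)\<^sup>*"
proof -
  interpret pair_fin_digraph F
    using F by (rule rooted_forest_finite)
  have "wf (parcs F)"
    using F pair_finite_arcs by (intro finite_acyclic_wf) (auto simp: rooted_forest_def)
  then have "v \<in> pverts F \<longrightarrow> (\<exists>r\<in>roots F. (r, v) \<in> (parcs F)\<^sup>*)"
  proof (induction v)
    case (less v)
    then show ?case
      using roots_iff[OF rooted_forest_finite[OF F], of v] wellformed'(1)
      by (metis rtrancl.rtrancl_refl rtrancl_into_rtrancl)
  qed
  then show ?thesis
    using v that by blast
qed

lemma ex_leaf_below: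
  assumes F: "rooted_forest F" and v: "v \<in> pverts F"
  obtains l where "l \<in> leaves F" "(v, l) \<in> (parcs F)\<^sup>*"
proof -
  interpret pair_fin_digraph F
    using F by (rule rooted_forest_finite)
  have "wf ((parcs F)\<inverse>)"
    using F pair_finite_arcs by (intro finite_acyclic_wf_converse) (auto simp: rooted_forest_def)
  then have "v \<in> pverts F \<longrightarrow> (\<exists>l\<in>leaves F. (v, l) \<in> (parcs F)\<^sup>*)"
  proof (induction v)
    case (less v)
    then show ?case
      using leaves_iff[OF rooted_forest_finite[OF F], of v] wellformed'(2)
      by (metis converse_iff converse_rtrancl_into_rtrancl rtrancl.rtrancl_refl)
  qed
  then show ?thesis
    using v that by blast
qed

lemma ex_apath:
  assumes F: "rooted_forest F" and u: "u \<in> pverts F" and uv: "(u, v) \<in> (parcs F)\<^sup>*"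
  obtains p where "pre_digraph.apath (with_proj F) u p v"
proof -
  interpret pair_fin_digraph F
    using F by (rule rooted_forest_finite)
  have "\<exists>p. awalk u p v"
    using uv
  proof (induction rule: rtrancl_induct)
    case base
    show ?case
      using u by (intro exI[of _ "[]"]) (simp add: awalk_Nil_iff)
  next
    case (step y z)
    then obtain p where "awalk u p y"
      by blast
    then have "awalk u (p @ [(y, z)]) z"
      using step.hyps wellformed' by (auto simp: awalk_simps)
    then show ?case
      by blast
  qed
  then show ?thesis
    using apath_awalk_to_apath that by blast
qed

text \<open>The union over all roots and paths collapses, as every path from a root to
  \<open>v\<close> has this same arc set and at least one exists.\<close>

lemma root_path_arcs_eq:
  assumes F: "rooted_forest F" and v: "v \<in> pverts F"
  shows "root_path_arcs F v = {e \<in> parcs F. (snd e, v) \<in> (parcs F)\<^sup>*}"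
proof -
  interpret pair_fin_digraph F
    using F by (rule rooted_forest_finite)
  obtain r where r: "r \<in> roots F" "(r, v) \<in> (parcs F)\<^sup>*"
    using ex_root_above[OF F v] .
  moreover have "r \<in> pverts F"
    using r by (simp add: roots_def)
  ultimately obtain p where "apath r p v"
    using ex_apath[OF F] by metis
  moreover have "set q = {e \<in> parcs F. (snd e, v) \<in> (parcs F)\<^sup>*}"
    if "r' \<in> roots F" "apath r' q v" for r' q
    using arcs_of_walk_from_root(1)[OF F that(1) awalkI_apath[OF that(2)]] .
  ultimately have "{set q | r' q. r' \<in> roots F \<and> apath r' q v} = {{e \<in> parcs F. (snd e, v) \<in> (parcs F)\<^sup>*}}"
    using r(1) by blast
  then show ?thesis
    by (simp add: root_path_arcs_def)
qed

section \<open>Depth and height in terms of ancestor sets\<close>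

lemma finite_root_leaf_paths:
  assumes "rooted_forest F"
  shows "finite (root_leaf_paths F)"
proof -
  interpret pair_fin_digraph F
    using assms by (rule rooted_forest_finite)
  have "root_leaf_paths F \<subseteq> (\<lambda>(u, p, v). p) ` {(u, p, v). apath u p v}"
    by (force simp: root_leaf_paths_def)
  then show ?thesis
    using apaths_finite_triple finite_surj by blast
qed

lemma root_leaf_pathE:
  assumes F: "rooted_forest F" and p: "p \<in> root_leaf_paths F"
  obtains r l where "r \<in> roots F" "l \<in> leaves F" "pre_digraph.awalk (with_proj F) r p l"
proof -
  interpret pair_fin_digraph F
    using F by (rule rooted_forest_finite)
  show ?thesis
    using p that awalkI_apath by (auto simp: root_leaf_paths_def)
qed

lemma ex_root_leaf_path_through:
  assumes F: "rooted_forest F" and v: "v \<in> pverts F"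
  obtains p r l where "p \<in> root_leaf_paths F" "r \<in> roots F" "pre_digraph.awalk (with_proj F) r p l"
    "(v, l) \<in> (parcs F)\<^sup>*"
proof -
  interpret pair_fin_digraph F
    using F by (rule rooted_forest_finite)
  obtain l where l: "l \<in> leaves F" "(v, l) \<in> (parcs F)\<^sup>*"
    using ex_leaf_below[OF F v] .
  obtain r where r: "r \<in> roots F" "(r, v) \<in> (parcs F)\<^sup>*"
    using ex_root_above[OF F v] .
  have "r \<in> pverts F" "(r, l) \<in> (parcs F)\<^sup>*"
    using r l by (auto simp: roots_def)
  then obtain p where "apath r p l"
    using ex_apath[OF F] by metis
  then show ?thesis
    using that[of p r l] l r awalkI_apath by (auto simp: root_leaf_paths_def)
qed

lemma SUP_nat_le:
  fixes f :: "'p \<Rightarrow> nat"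
  assumes "\<And>p. p \<in> P \<Longrightarrow> f p \<le> h"
  shows "(SUP p\<in>P. f p) \<le> h"
  using assms by (cases "P = {}") (auto intro: cSUP_least)

lemma depth_le:
  assumes F: "rooted_forest F"
    and h: "\<And>v. v \<in> pverts F \<Longrightarrow> card {e \<in> parcs F. (snd e, v) \<in> (parcs F)\<^sup>*} \<le> h"
  shows "depth F \<le> h"
  unfolding depth_def
proof (rule SUP_nat_le)
  fix p assume "p \<in> root_leaf_paths F"
  then obtain r l where "r \<in> roots F" "l \<in> leaves F" "pre_digraph.awalk (with_proj F) r p l"
    using root_leaf_pathE[OF F] by metis
  then show "length p \<le> h"
    using arcs_of_walk_from_root(3)[OF F] h[of l] by (simp add: leaves_def)
qed

lemma height_le:
  assumes F: "rooted_forest F"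
    and h: "\<And>v. v \<in> pverts F \<Longrightarrow> card {w. (w, v) \<in> (parcs F)\<^sup>*} \<le> h"
  shows "height F \<le> h"
  unfolding height_def
proof (rule SUP_nat_le)
  fix p assume "p \<in> root_leaf_paths F"
  then obtain r l where "r \<in> roots F" "l \<in> leaves F" "pre_digraph.awalk (with_proj F) r p l"
    using root_leaf_pathE[OF F] by metis
  then show "Suc (length p) \<le> h"
    using arcs_of_walk_from_root(4)[OF F] h[of l] by (simp add: leaves_def)
qed

text \<open>Every vertex lies above some leaf, so its ancestor arcs are among those of a root-leaf
  path. There are finitely many such paths, which makes the supremum an upper bound.\<close>

lemma card_arcs_above_le_depth:
  assumes F: "rooted_forest F" and v: "v \<in> pverts F"
  shows "card {e \<in> parcs F. (snd e, v) \<in> (parcs F)\<^sup>*} \<le> depth F"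
proof -
  obtain p r l where p: "p \<in> root_leaf_paths F" "r \<in> roots F" "pre_digraph.awalk (with_proj F) r p l"
    "(v, l) \<in> (parcs F)\<^sup>*"
    using ex_root_leaf_path_through[OF F v] .
  have "card {e \<in> parcs F. (snd e, v) \<in> (parcs F)\<^sup>*} \<le> card (set p)"
    using p(4) unfolding arcs_of_walk_from_root(1)[OF F p(2,3)]
    by (intro card_mono) (auto simp: rooted_forest_finite[OF F] pair_fin_digraph.pair_finite_arcs)
  also have "\<dots> \<le> length p"
    by (rule card_length)
  also have "\<dots> \<le> depth F"
    unfolding depth_def using p(1) finite_root_leaf_paths[OF F] by (intro cSUP_upper) auto
  finally show ?thesis .
qed

lemma card_verts_above_le_height:
  assumes F: "rooted_forest F" and v: "v \<in> pverts F"
  shows "card {w. (w, v) \<in> (parcs F)\<^sup>*} \<le> height F"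
proof -
  obtain p r l where p: "p \<in> root_leaf_paths F" "r \<in> roots F" "pre_digraph.awalk (with_proj F) r p l"
    "(v, l) \<in> (parcs F)\<^sup>*"
    using ex_root_leaf_path_through[OF F v] .
  have "finite {w. (w, l) \<in> (parcs F)\<^sup>*}"
    by (simp only: arcs_of_walk_from_root(2)[OF F p(2,3)]) simp
  then have "card {w. (w, v) \<in> (parcs F)\<^sup>*} \<le> card {w. (w, l) \<in> (parcs F)\<^sup>*}"
    using p(4) by (intro card_mono) (auto intro: rtrancl_trans)
  also have "\<dots> = Suc (length p)"
    by (rule arcs_of_walk_from_root(4)[OF F p(2,3)])
  also have "\<dots> \<le> height F"
    unfolding height_def using p(1) finite_root_leaf_paths[OF F] by (intro cSUP_upper) auto
  finally show ?thesis .
qed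

lemma card_arcs_rooted_forest:
  assumes F: "rooted_forest F"
  shows "card (parcs F) = card (pverts F - roots F)"
proof -
  interpret pair_fin_digraph F
    using F by (rule rooted_forest_finite)
  have "snd ` parcs F = pverts F - roots F"
    using roots_iff[OF rooted_forest_finite[OF F]] wellformed'(2) by force
  then show ?thesis
    using card_image[OF rooted_forest_inj_snd[OF F]] by simp
qed

section \<open>Forests as covering relations of strict orders\<close>

definition covers :: "'v rel \<Rightarrow> 'v rel" where
  "covers s = {(u, v) \<in> s. \<not> (\<exists>w. (u, w) \<in> s \<and> (w, v) \<in> s)}"

text \<open>Induction on the number of elements strictly between \<open>u\<close> and
  \<open>v\<close>: any \<open>w\<close> between them splits the interval into two smaller ones,
  both missing \<open>w\<close> by irreflexivity.\<close>

lemma trancl_covers: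
  assumes "finite s" "trans s" "irrefl s"
  shows "(covers s)\<^sup>+ = s"
proof
  have "(covers s)\<^sup>+ \<subseteq> s\<^sup>+"
    by (rule trancl_mono_subset) (auto simp: covers_def)
  then show "(covers s)\<^sup>+ \<subseteq> s"
    using assms(2) by (simp add: trancl_id)
  have "(u, v) \<in> s \<Longrightarrow> (u, v) \<in> (covers s)\<^sup>+" for u v
  proof (induction "card {w. (u, w) \<in> s \<and> (w, v) \<in> s}" arbitrary: u v rule: less_induct)
    case less
    let ?I = "\<lambda>u v. {w. (u, w) \<in> s \<and> (w, v) \<in> s}"
    have fin: "finite (?I u v)"
      using finite_subset[of "?I u v" "snd ` s"] assms(1) by force
    show ?case
    proof (cases "?I u v = {}")
      case True
      then show ?thesis
        using less.prems by (auto simp: covers_def)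
    next
      case False
      then obtain w where w: "(u, w) \<in> s" "(w, v) \<in> s"
        by blast
      have "?I u w \<subset> ?I u v" "?I w v \<subset> ?I u v"
        using w assms(2,3) unfolding irrefl_def by (auto dest: transD)
      then have "card (?I u w) < card (?I u v)" "card (?I w v) < card (?I u v)"
        using fin by (simp_all add: psubset_card_mono)
      then show ?thesis
        using less.hyps w by (meson trancl_trans)
    qed
  qed
  then show "s \<subseteq> (covers s)\<^sup>+"
    by auto
qed

text \<open>Both constructions in the main argument specify a forest by its ancestor order. Two
  distinct parents of a vertex would be comparable, and the lower one would lie between the other
  and the vertex, contrary to covering.\<close>

lemma rooted_forest_covers:
  assumes "finite V" "s \<subseteq> V \<times> V" "trans s" "irrefl s"
    and chain: "\<And>u v w. (u, w) \<in> s \<Longrightarrow> (v, w) \<in> s \<Longrightarrow> u = v \<or> (u, v) \<in> s \<or> (v, u) \<in> s"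
  defines "F \<equiv> \<lparr>pverts = V, parcs = covers s\<rparr>"
  shows "rooted_forest F" and "(parcs F)\<^sup>+ = s" and "roots F = {v \<in> V. \<forall>u. (u, v) \<notin> s}"
proof -
  have fin: "finite s"
    using assms(1,2) finite_subset by blast
  have sub: "covers s \<subseteq> s"
    by (auto simp: covers_def)
  interpret pair_fin_digraph F
    using assms(1,2) sub finite_subset[OF sub fin] by unfold_locales (auto simp: F_def)
  show tr: "(parcs F)\<^sup>+ = s"
    using trancl_covers[OF fin assms(3,4)] by (simp add: F_def)
  have "acyclic (parcs F)"
    using assms(4) by (simp add: acyclic_def tr irrefl_def)
  moreover have "in_degree (with_proj F) v \<le> 1" for v
  proof -
    have "e = e'" if "e \<in> in_arcs (with_proj F) v" "e' \<in> in_arcs (with_proj F) v" for e e'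
    proof -
      have *: "e \<in> covers s" "e' \<in> covers s" "snd e = v" "snd e' = v"
        using that by (auto simp: F_def)
      then have "(fst e, v) \<in> covers s" "(fst e', v) \<in> covers s"
        by (metis prod.collapse)+
      moreover from this have "fst e = fst e'"
        using chain[of "fst e" v "fst e'"] by (auto simp: covers_def)
      ultimately show ?thesis
        using * by (simp add: prod_eq_iff)
    qed
    moreover have "finite (in_arcs (with_proj F) v)"
      by (rule finite_in_arcs)
    ultimately show ?thesis
      by (simp add: in_degree_def card_le_Suc0_iff_eq del: in_in_arcs_conv)
  qed
  ultimately show "rooted_forest F"
    unfolding rooted_forest_def using pair_fin_digraph by auto
  have "(\<forall>u. (u, v) \<notin> parcs F) \<longleftrightarrow> (\<forall>u. (u, v) \<notin> s)" for v
    unfolding tr[symmetric] by (auto elim: tranclE)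
  then show "roots F = {v \<in> V. \<forall>u. (u, v) \<notin> s}"
    by (auto simp: roots_iff[OF pair_fin_digraph]) (auto simp: F_def)
qed

section \<open>Tree-depth through embeddings into forest closures\<close>

definition closure_embedding :: "('v \<Rightarrow> 'w) \<Rightarrow> 'v pair_pre_digraph \<Rightarrow> 'w pair_pre_digraph \<Rightarrow> bool" where
  "closure_embedding \<phi> G F \<longleftrightarrow>
     inj_on \<phi> (pverts G) \<and> \<phi> ` pverts G \<subseteq> pverts F \<and>
     (\<forall>(u, v)\<in>parcs G. (\<phi> u, \<phi> v) \<in> parcs (forest_closure F))"

lemma ex_iso_subgraph_closure_iff:
  assumes G: "pair_wf_digraph G" and F: "rooted_forest F"
  shows "(\<exists>H. digraph_iso (with_proj G) H \<and> subgraph H (with_proj (forest_closure F))) \<longleftrightarrow>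
    (\<exists>\<phi>. closure_embedding \<phi> G F)"
proof
  assume "\<exists>H. digraph_iso (with_proj G) H \<and> subgraph H (with_proj (forest_closure F))"
  then obtain h where h: "pre_digraph.digraph_isomorphism (with_proj G) h"
      "subgraph (app_iso h (with_proj G)) (with_proj (forest_closure F))"
    by (auto simp: digraph_iso_def)
  \<comment> \<open>A subgraph shares the head and tail maps of its host. They are projections here,
    so the arc map is determined by the vertex map.\<close>
  then have proj: "iso_tail h = fst" "iso_head h = snd"
    by (auto simp: subgraph_def compatible_def)
  have "closure_embedding (iso_verts h) G F"
    unfolding closure_embedding_def
  proof (intro conjI ballI, goal_cases)
    case 1
    then show ?case
      using h(1) by (simp add: pre_digraph.digraph_isomorphism_def)
  next
    case 2
    then show ?case
      using h(2) by (simp add: subgraph_def forest_closure_def)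
  next
    case (3 a)
    then have "iso_arcs h a \<in> parcs (forest_closure F)"
      using h(2) by (auto simp: subgraph_def)
    moreover have "iso_arcs h a = (iso_verts h (fst a), iso_verts h (snd a))"
      using 3 h(1) proj by (simp add: pre_digraph.digraph_isomorphism_def prod_eq_iff)
    ultimately show ?case
      by (auto split: prod.split)
  qed
  then show "\<exists>\<phi>. closure_embedding \<phi> G F"
    by blast
next
  assume "\<exists>\<phi>. closure_embedding \<phi> G F"
  then obtain \<phi> where \<phi>: "closure_embedding \<phi> G F" ..
  interpret pair_wf_digraph G
    by fact
  interpret F: pair_fin_digraph F
    using F by (rule rooted_forest_finite)
  define h where "h = \<lparr>iso_verts = \<phi>, iso_arcs = map_prod \<phi> \<phi>, iso_head = snd, iso_tail = fst\<rparr>"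
  have "parcs G \<subseteq> pverts G \<times> pverts G"
    using wellformed' by auto
  then have "inj_on (map_prod \<phi> \<phi>) (parcs G)"
    using \<phi> inj_on_subset[OF map_prod_inj_on] by (metis closure_embedding_def)
  then have h: "pre_digraph.digraph_isomorphism (with_proj G) h"
    using \<phi> wf_digraph_axioms
    by (auto simp: pre_digraph.digraph_isomorphism_def h_def closure_embedding_def)
  have "parcs F \<subseteq> pverts F \<times> pverts F"
    using F.wellformed' by auto
  then have "(parcs F)\<^sup>+ \<subseteq> pverts F \<times> pverts F"
    by (rule trancl_subset_Sigma)
  then have "wf_digraph (with_proj (forest_closure F))"
    by unfold_locales (auto simp: forest_closure_def)
  moreover have "wf_digraph (app_iso h (with_proj G))"
    using h by (rule wf_digraphI_app_iso)
  ultimately have "subgraph (app_iso h (with_proj G)) (with_proj (forest_closure F))"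
    using \<phi> by (auto simp: subgraph_def compatible_def h_def closure_embedding_def)
      (auto simp: forest_closure_def)
  then show "\<exists>H. digraph_iso (with_proj G) H \<and> subgraph H (with_proj (forest_closure F))"
    using h by (auto simp: digraph_iso_def)
qed

lemma tree_depth_eq:
  assumes "pair_wf_digraph G"
  shows "tree_depth G = (LEAST h. \<exists>(F :: nat pair_pre_digraph) \<phi>.
    rooted_forest F \<and> closure_embedding \<phi> G F \<and> height F = h)"
  unfolding tree_depth_def using ex_iso_subgraph_closure_iff[OF assms]
  by (intro arg_cong[where f = Least]) (auto simp: fun_eq_iff, blast+)

text \<open>The order is transported to natural numbers by an injection, and its covering relation
  is the forest. The strict bound on strict predecessors becomes \<open>height F \<le> h\<close>
  because height also counts the vertex itself.\<close>

lemma ex_closure_embedding: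
  fixes G :: "'v pair_pre_digraph"
  assumes fin: "finite (pverts G)" and s: "s \<subseteq> pverts G \<times> pverts G" "trans s" "irrefl s"
    and chain: "\<And>u v w. (u, w) \<in> s \<Longrightarrow> (v, w) \<in> s \<Longrightarrow> u = v \<or> (u, v) \<in> s \<or> (v, u) \<in> s"
    and adj: "\<And>u v. (u, v) \<in> parcs G \<Longrightarrow> (u, v) \<in> s \<or> (v, u) \<in> s"
    and h: "\<And>v. v \<in> pverts G \<Longrightarrow> card {u. (u, v) \<in> s} < h"
  obtains F :: "nat pair_pre_digraph" and \<phi> where
    "rooted_forest F" "closure_embedding \<phi> G F" "height F \<le> h"
proof -
  obtain \<phi> :: "'v \<Rightarrow> nat" where \<phi>: "inj_on \<phi> (pverts G)"
    using finite_imp_inj_to_nat_seg[OF fin] by blast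
  have s_iff: "(\<phi> u, \<phi> v) \<in> map_prod \<phi> \<phi> ` s \<longleftrightarrow> (u, v) \<in> s"
    if "u \<in> pverts G" "v \<in> pverts G" for u v
    using inj_on_image_mem_iff[OF map_prod_inj_on[OF \<phi> \<phi>], of "(u, v)" s] that s(1) by simp
  let ?V = "\<phi> ` pverts G" and ?s = "map_prod \<phi> \<phi> ` s"
  let ?F = "\<lparr>pverts = ?V, parcs = covers ?s\<rparr>"
  have V: "finite ?V"
    using fin by simp
  have sV: "?s \<subseteq> ?V \<times> ?V"
    using s(1) by auto
  have tr: "trans ?s"
  proof (rule transI)
    fix x y z assume *: "(x, y) \<in> ?s" "(y, z) \<in> ?s"
    then obtain u v w where "x = \<phi> u" "y = \<phi> v" "z = \<phi> w"
      "u \<in> pverts G" "v \<in> pverts G" "w \<in> pverts G"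
      using sV by blast
    then show "(x, z) \<in> ?s"
      using * s(2) by (simp add: s_iff) (meson transD)
  qed
  have irr: "irrefl ?s"
    using s sV s_iff by (auto simp: irrefl_def) (metis mem_Sigma_iff subsetD)
  have ch: "x = y \<or> (x, y) \<in> ?s \<or> (y, x) \<in> ?s" if *: "(x, z) \<in> ?s" "(y, z) \<in> ?s" for x y z
  proof -
    obtain u v w where "x = \<phi> u" "y = \<phi> v" "z = \<phi> w"
      "u \<in> pverts G" "v \<in> pverts G" "w \<in> pverts G"
      using sV * by blast
    then show ?thesis
      using * chain[of u w v] by (auto simp: s_iff)
  qed
  have F: "rooted_forest ?F" "(parcs ?F)\<^sup>+ = ?s"
    by (rule rooted_forest_covers[OF V sV tr irr], erule (1) ch)+
  have trancl: "(covers ?s)\<^sup>+ = ?s"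
    using F(2) by simp
  then have "closure_embedding \<phi> G ?F"
    using \<phi> adj by (fastforce simp: closure_embedding_def forest_closure_def intro: map_prod_imageI)
  moreover have "height ?F \<le> h"
  proof (rule height_le[OF F(1)])
    fix x assume "x \<in> pverts ?F"
    then obtain v where v: "v \<in> pverts G" "x = \<phi> v"
      by auto
    have fv: "finite {u. (u, v) \<in> s}"
      using s(1) fin by (auto intro: finite_subset)
    have "(w, x) \<in> (parcs ?F)\<^sup>* \<longleftrightarrow> w = x \<or> (w, x) \<in> ?s" for w
      unfolding rtrancl_eq_or_trancl using trancl by auto
    then have "{w. (w, x) \<in> (parcs ?F)\<^sup>*} = insert x {w. (w, x) \<in> ?s}"
      by blast
    also have "\<dots> \<subseteq> insert x (\<phi> ` {u. (u, v) \<in> s})"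
    proof (intro insert_mono subsetI)
      fix w assume "w \<in> {w. (w, x) \<in> ?s}"
      then have w: "(w, x) \<in> ?s"
        by simp
      then obtain u where "u \<in> pverts G" "w = \<phi> u"
        using subsetD[OF sV w] by auto
      then show "w \<in> \<phi> ` {u. (u, v) \<in> s}"
        using w v s_iff by auto
    qed
    finally have "card {w. (w, x) \<in> (parcs ?F)\<^sup>*} \<le> card (insert x (\<phi> ` {u. (u, v) \<in> s}))"
      using fv by (intro card_mono) auto
    also have "\<dots> \<le> Suc (card {u. (u, v) \<in> s})"
      using card_image_le[OF fv, of \<phi>] fv by (simp add: card_insert_if)
    also have "\<dots> \<le> h"
      using h[OF v(1)] by simp
    finally show "card {w. (w, x) \<in> (parcs ?F)\<^sup>*} \<le> h" .
  qed
  ultimately show ?thesis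
    using F(1) that by blast
qed

lemma tree_depth_le_height:
  fixes F :: "nat pair_pre_digraph"
  assumes "pair_wf_digraph G" "rooted_forest F" "closure_embedding \<phi> G F"
  shows "tree_depth G \<le> height F"
  unfolding tree_depth_eq[OF assms(1)] using assms by (intro Least_le) blast

lemma tree_depth_attained:
  fixes G :: "'v pair_pre_digraph"
  assumes "pair_digraph G"
  obtains F :: "nat pair_pre_digraph" and \<phi> where
    "rooted_forest F" "closure_embedding \<phi> G F" "height F = tree_depth G"
proof -
  interpret pair_digraph G
    by fact
  obtain \<psi> :: "'v \<Rightarrow> nat" where \<psi>: "inj_on \<psi> (pverts G)"
    using finite_imp_inj_to_nat_seg[OF pair_finite_verts] by blast
  \<comment> \<open>A linear order of all vertices gives a forest that is a path, whose closure
    contains every loopless graph on them. So some forest exists and the \<open>LEAST\<close> is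
    attained.\<close>
  let ?s = "{(u, v) \<in> pverts G \<times> pverts G. \<psi> u < \<psi> v}"
  have le: "card {u. (u, v) \<in> ?s} < Suc (card (pverts G))" for v
    using pair_finite_verts by (auto simp: less_Suc_eq_le intro!: card_mono)
  have "\<exists>(F :: nat pair_pre_digraph) \<phi>. rooted_forest F \<and> closure_embedding \<phi> G F"
  proof (rule ex_closure_embedding[of G ?s "Suc (card (pverts G))"])
    show "finite (pverts G)"
      by (rule pair_finite_verts)
    show "?s \<subseteq> pverts G \<times> pverts G" "trans ?s" "irrefl ?s"
      by (auto simp: trans_def irrefl_def)
    show "u = v \<or> (u, v) \<in> ?s \<or> (v, u) \<in> ?s" if "(u, w) \<in> ?s" "(v, w) \<in> ?s" for u v w
      using that \<psi> by (auto simp: inj_on_def) (metis linorder_neqE_nat)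
    show "(u, v) \<in> ?s \<or> (v, u) \<in> ?s" if "(u, v) \<in> parcs G" for u v
      using that \<psi> wellformed' no_loops' by (auto simp: inj_on_def) (metis linorder_neqE_nat)
  qed (use le in blast)+
  then have "\<exists>h (F :: nat pair_pre_digraph) \<phi>. rooted_forest F \<and> closure_embedding \<phi> G F \<and> height F = h"
    by blast
  from LeastI_ex[OF this] show ?thesis
    using that unfolding tree_depth_eq[OF pair_wf_digraph_axioms] by blast
qed

section \<open>Branch-depth and dual tree-depth\<close>

lemma pair_digraph_dual_graph: "pair_digraph (dual_graph A)"
  by unfold_locales (auto simp: dual_graph_def)

lemma ex_depth_decomposition:
  fixes A :: "'a::field ^ 'n ^ 'm" and F :: "nat pair_pre_digraph"
  assumes F: "rooted_forest F" and emb: "closure_embedding \<phi> (dual_graph A) F"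
  obtains T :: "nat pair_pre_digraph" and f where
    "depth_decomposition UNIV (column_indep A) T f" "depth T \<le> height F"
proof -
  obtain I where I: "inj_on (\<lambda>i. row i A) I" "vec.independent ((\<lambda>i. row i A) ` I)"
    "vec.span (rows A) = vec.span ((\<lambda>i. row i A) ` I)" "card I = vec.dim (rows A)"
    using row_basis .
  have inj: "inj \<phi>" and \<phi>_verts: "range \<phi> \<subseteq> pverts F"
    using emb by (auto simp: closure_embedding_def dual_graph_def)
  have adj: "(\<phi> i, \<phi> k) \<in> (parcs F)\<^sup>+ \<or> (\<phi> k, \<phi> i) \<in> (parcs F)\<^sup>+"
    if "i \<noteq> k" "A $ i $ j \<noteq> 0" "A $ k $ j \<noteq> 0" for i k j
    using that emb by (auto simp: closure_embedding_def dual_graph_def forest_closure_def)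
  \<comment> \<open>The ancestor order of \<open>F\<close> on the basis rows, shifted to make room for the new root 0.\<close>
  define s where "s = {(0, Suc v) | v. v \<in> \<phi> ` I} \<union>
    {(Suc u, Suc v) | u v. u \<in> \<phi> ` I \<and> v \<in> \<phi> ` I \<and> (u, v) \<in> (parcs F)\<^sup>+}"
  have s_0: "(x, 0) \<notin> s" and s_0_Suc: "(0, Suc v) \<in> s \<longleftrightarrow> v \<in> \<phi> ` I"
    and s_Suc: "(Suc u, Suc v) \<in> s \<longleftrightarrow> u \<in> \<phi> ` I \<and> v \<in> \<phi> ` I \<and> (u, v) \<in> (parcs F)\<^sup>+" for x u v
    by (auto simp: s_def)
  let ?V = "insert 0 (Suc ` \<phi> ` I)"
  define T where "T = \<lparr>pverts = ?V, parcs = covers s\<rparr>"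
  have V: "finite ?V" "s \<subseteq> ?V \<times> ?V"
    by (auto simp: s_def)
  have tr: "trans s"
  proof (rule transI)
    fix x y z assume "(x, y) \<in> s" "(y, z) \<in> s"
    then show "(x, z) \<in> s"
      by (cases x; cases y; cases z) (auto simp: s_0 s_0_Suc s_Suc)
  qed
  have irr: "irrefl s"
    using F by (auto simp: irrefl_def s_def rooted_forest_def acyclic_def)
  have chain: "x = y \<or> (x, y) \<in> s \<or> (y, x) \<in> s" if "(x, z) \<in> s" "(y, z) \<in> s" for x y z
  proof (cases "x = 0 \<or> y = 0")
    case True
    have "x \<in> ?V" "y \<in> ?V"
      by (rule SigmaD1[OF subsetD[OF V(2) that(1)]], rule SigmaD1[OF subsetD[OF V(2) that(2)]])
    then show ?thesis
      using True by (auto simp: s_0_Suc)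
  next
    case False
    then obtain u v where "x = Suc u" "y = Suc v"
      by (auto simp: gr0_conv_Suc)
    moreover have "z \<noteq> 0"
      using that(1) s_0 by (cases z) auto
    then obtain w where "z = Suc w"
      by (auto simp: gr0_conv_Suc)
    ultimately have xyz: "x = Suc u" "y = Suc v" "z = Suc w"
      by auto
    then have "(u, v) \<in> (parcs F)\<^sup>* \<or> (v, u) \<in> (parcs F)\<^sup>*"
      using that rooted_forest_ancestors_chain[OF F, of u w v] by (auto simp: s_Suc intro: trancl_into_rtrancl)
    then show ?thesis
      using that unfolding xyz s_Suc rtrancl_eq_or_trancl by auto
  qed
  have T: "rooted_forest T" and T_trancl: "(parcs T)\<^sup>+ = s" and roots: "roots T = {v \<in> ?V. \<forall>u. (u, v) \<notin> s}"
    unfolding T_def by (rule rooted_forest_covers[OF V tr irr], erule (1) chain)+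
  have T_rtrancl: "(x, y) \<in> (parcs T)\<^sup>* \<longleftrightarrow> x = y \<or> (x, y) \<in> s" for x y
    unfolding rtrancl_eq_or_trancl T_trancl by auto
  have verts_T: "pverts T = ?V"
    by (simp add: T_def)
  interpret T: pair_fin_digraph T
    using T by (rule rooted_forest_finite)
  have "(0, Suc (\<phi> i)) \<in> s" if "i \<in> I" for i
    using that by (simp add: s_0_Suc)
  then have roots_T: "roots T = {0}"
    unfolding roots using s_0 by blast
  then have "rooted_tree T"
    using T by (simp add: rooted_tree_def)
  \<comment> \<open>Each vertex except the added root has exactly one incoming arc, so the edges of
    \<open>T\<close> correspond to the basis rows.\<close>
  have "card (parcs T) = card (Suc ` \<phi> ` I)"
    unfolding card_arcs_rooted_forest[OF T] roots_T verts_T by (intro arg_cong[where f = card]) auto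
  also have "\<dots> = card I"
    using inj by (simp add: card_image inj_on_subset)
  finally have card_T: "card (parcs T) = matroid_rank (column_indep A) UNIV"
    by (simp add: I(4) matroid_rank_UNIV_eq_dim_rows)
  \<comment> \<open>The basis rows non-zero in column \<open>j\<close> form a chain. Its lowest
    element, or the root if the chain is empty, is \<open>w\<close>; any leaf below \<open>w\<close>
    will do.\<close>
  have "\<exists>l. l \<in> leaves T \<and> (\<forall>i\<in>I. A $ i $ j \<noteq> 0 \<longrightarrow> (Suc (\<phi> i), l) \<in> (parcs T)\<^sup>*)" for j
  proof -
    have "\<exists>w\<in>insert 0 (Suc ` \<phi> ` N). \<forall>i\<in>N. (Suc (\<phi> i), w) \<in> (parcs T)\<^sup>*"
      if "finite N" "N \<subseteq> {i \<in> I. A $ i $ j \<noteq> 0}" for N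
      using that
    proof induction
      case empty
      then show ?case
        by simp
    next
      case (insert i N)
      then obtain w where w: "w \<in> insert 0 (Suc ` \<phi> ` N)" "\<forall>i\<in>N. (Suc (\<phi> i), w) \<in> (parcs T)\<^sup>*"
        by auto
      have "(w, Suc (\<phi> i)) \<in> s \<or> (Suc (\<phi> i), w) \<in> s"
      proof (cases "w = 0")
        case True
        then show ?thesis
          using insert.prems by (simp add: s_0_Suc)
      next
        case False
        then obtain k where k: "k \<in> N" "w = Suc (\<phi> k)"
          using w(1) by auto
        then show ?thesis
          using insert adj[of i k j] by (auto simp: s_Suc)
      qed
      then show ?case
      proof
        assume "(w, Suc (\<phi> i)) \<in> s"
        then have "(w, Suc (\<phi> i)) \<in> (parcs T)\<^sup>*"
          by (simp add: T_rtrancl)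
        then have "\<forall>k\<in>insert i N. (Suc (\<phi> k), Suc (\<phi> i)) \<in> (parcs T)\<^sup>*"
          using w(2) by (auto intro: rtrancl_trans)
        then show ?thesis
          by blast
      next
        assume "(Suc (\<phi> i), w) \<in> s"
        then have "\<forall>k\<in>insert i N. (Suc (\<phi> k), w) \<in> (parcs T)\<^sup>*"
          using w(2) by (simp add: T_rtrancl)
        then show ?thesis
          using w(1) by blast
      qed
    qed
    from this[of "{i \<in> I. A $ i $ j \<noteq> 0}"] obtain w where w: "w \<in> pverts T"
      "\<And>i. i \<in> I \<Longrightarrow> A $ i $ j \<noteq> 0 \<Longrightarrow> (Suc (\<phi> i), w) \<in> (parcs T)\<^sup>*"
      unfolding verts_T by auto
    obtain l where "l \<in> leaves T" "(w, l) \<in> (parcs T)\<^sup>*"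
      using ex_leaf_below[OF T w(1)] .
    then show ?thesis
      using w(2) by (meson rtrancl_trans)
  qed
  then obtain f where f: "\<And>j. f j \<in> leaves T"
    "\<And>i j. i \<in> I \<Longrightarrow> A $ i $ j \<noteq> 0 \<Longrightarrow> (Suc (\<phi> i), f j) \<in> (parcs T)\<^sup>*"
    by metis
  have rank: "matroid_rank (column_indep A) Y \<le> card (\<Union>j\<in>Y. root_path_arcs T (f j))" for Y
  proof -
    \<comment> \<open>Basis rows outside \<open>?K\<close> vanish on \<open>Y\<close>, so the rank
      is at most \<open>card ?K\<close>. Each row in \<open>?K\<close> is the head of an arc on the
      path to some \<open>f j\<close> with \<open>j \<in> Y\<close>.\<close>
    let ?K = "{i \<in> I. \<exists>j\<in>Y. A $ i $ j \<noteq> 0}"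
    let ?arcs = "\<Union>j\<in>Y. root_path_arcs T (f j)"
    have path: "root_path_arcs T (f j) = {e \<in> parcs T. (snd e, f j) \<in> (parcs T)\<^sup>*}" for j
      using f(1)[of j] by (intro root_path_arcs_eq[OF T]) (simp add: leaves_def)
    have "matroid_rank (column_indep A) Y = vec.dim (restrict_to Y ` (\<lambda>i. row i A) ` I)"
      by (simp add: matroid_rank_row_space I(3) dim_image_span[OF linear_restrict_to])
    also have "\<dots> \<le> card (restrict_to Y ` (\<lambda>i. row i A) ` ?K)"
    proof (intro vec.dim_le_card subsetI)
      fix x assume "x \<in> restrict_to Y ` (\<lambda>i. row i A) ` I"
      then obtain i where i: "i \<in> I" "x = restrict_to Y (row i A)"
        by auto
      show "x \<in> vec.span (restrict_to Y ` (\<lambda>i. row i A) ` ?K)"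
      proof (cases "i \<in> ?K")
        case True
        then show ?thesis
          unfolding i(2) by (intro vec.span_base imageI)
      next
        case False
        then have "x = 0"
          using i by (auto simp: vec_eq_iff row_def)
        then show ?thesis
          by (simp add: vec.span_zero)
      qed
    qed simp
    also have "\<dots> \<le> card ?K"
      by (simp add: card_image_le image_image)
    also have "\<dots> = card (Suc ` \<phi> ` ?K)"
      using inj by (simp add: card_image inj_on_subset)
    also have "\<dots> \<le> card (snd ` ?arcs)"
    proof (intro card_mono subsetI)
      show "finite (snd ` ?arcs)"
        unfolding path by (rule finite_imageI, rule finite_subset[OF _ T.pair_finite_arcs]) auto
      fix x assume "x \<in> Suc ` \<phi> ` ?K"
      then obtain i j where i: "i \<in> I" "j \<in> Y" "A $ i $ j \<noteq> 0" "x = Suc (\<phi> i)"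
        by auto
      have "x \<in> pverts T - roots T"
        using i by (auto simp: verts_T roots_T)
      then obtain u where "(u, x) \<in> parcs T"
        using roots_iff[OF T.pair_fin_digraph] by auto
      moreover have "(x, f j) \<in> (parcs T)\<^sup>*"
        using f(2) i by simp
      ultimately show "x \<in> snd ` ?arcs"
        unfolding path using i(2) by force
    qed
    also have "\<dots> \<le> card ?arcs"
      unfolding path by (rule card_image_le, rule finite_subset[OF _ T.pair_finite_arcs]) auto
    finally show ?thesis .
  qed
  \<comment> \<open>The added root costs nothing: depth counts edges, and the heads of the arcs
    above \<open>Suc u\<close> come from vertices weakly above \<open>u\<close> in \<open>F\<close>,
    which height counts.\<close>
  have "depth T \<le> height F"
  proof (rule depth_le[OF T])
    fix v assume v: "v \<in> pverts T"
    let ?arcs = "{e \<in> parcs T. (snd e, v) \<in> (parcs T)\<^sup>*}"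
    have head: "snd e \<in> Suc ` \<phi> ` I" if "e \<in> parcs T" for e
      using that roots_iff[OF T.pair_fin_digraph, of "snd e"] T.arc_snd_in_verts[OF that]
      by (cases e) (auto simp: verts_T roots_T)
    have "card ?arcs = card (snd ` ?arcs)"
      using inj_on_subset[OF rooted_forest_inj_snd[OF T], of ?arcs] by (simp add: card_image)
    also have "\<dots> \<le> height F"
    proof (cases v)
      case 0
      then have "?arcs = {}"
        using head by (fastforce simp: T_rtrancl s_0)
      then have "card (snd ` ?arcs) = 0"
        by (simp only: image_empty card.empty)
      then show ?thesis
        by linarith
    next
      case (Suc u)
      then have u: "u \<in> pverts F"
        using v \<phi>_verts by (auto simp: verts_T)
      have "snd ` ?arcs \<subseteq> Suc ` {w. (w, u) \<in> (parcs F)\<^sup>*}"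
        using head by (fastforce simp: T_rtrancl Suc s_Suc intro: trancl_into_rtrancl)
      moreover have "finite {w. (w, u) \<in> (parcs F)\<^sup>*}"
        using finite_ancestors[OF F u] .
      ultimately have "card (snd ` ?arcs) \<le> card (Suc ` {w. (w, u) \<in> (parcs F)\<^sup>*})"
        by (intro card_mono) auto
      also have "\<dots> \<le> height F"
        using card_verts_above_le_height[OF F u] by (simp add: card_image)
      finally show ?thesis .
    qed
    finally show "card ?arcs \<le> height F" .
  qed
  moreover have "depth_decomposition UNIV (column_indep A) T f"
    using \<open>rooted_tree T\<close> card_T f(1) rank by (auto simp: depth_decomposition_def)
  ultimately show ?thesis
    using that by blast
qed

lemma ex_row_equivalent_tree_depth_le:
  fixes A :: "'a::field ^ 'n ^ 'm" and T :: "'v pair_pre_digraph"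
  assumes "A \<noteq> 0" and dd: "depth_decomposition UNIV (column_indep A) T f"
  obtains A' where "row_equivalent A A'" "dual_tree_depth A' \<le> depth T"
proof -
  let ?R = "vec.span (rows A)"
  let ?E = "parcs T"
  have T: "rooted_forest T" and card_T: "card ?E = vec.dim ?R" and f: "\<And>j. f j \<in> pverts T"
    and rank: "\<And>Y. matroid_rank (column_indep A) Y \<le> card (\<Union>j\<in>Y. root_path_arcs T (f j))"
    using dd by (auto simp: depth_decomposition_def rooted_tree_def leaves_def matroid_rank_UNIV_eq_dim_rows)
  interpret T: pair_fin_digraph T
    using T by (rule rooted_forest_finite)
  define s where "s = {(e, e'). e \<in> ?E \<and> e' \<in> ?E \<and> (snd e, snd e') \<in> ?E\<^sup>+}"
  define X where "X e = {j. (snd e, f j) \<in> ?E\<^sup>*}" for e :: "'v \<times> 'v"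
  have s_subset: "s \<subseteq> ?E \<times> ?E"
    by (auto simp: s_def)
  have trans: "trans s"
    by (auto simp: s_def intro!: transI)
  have irrefl: "irrefl s"
    using T by (auto simp: s_def irrefl_def rooted_forest_def acyclic_def)
  have "acyclic s"
    using trans irrefl by (simp add: acyclic_def irrefl_def trancl_id)
  have comparable: "e = e' \<or> (e, e') \<in> s \<or> (e', e) \<in> s"
    if "e \<in> ?E" "e' \<in> ?E" "(snd e, v) \<in> ?E\<^sup>*" "(snd e', v) \<in> ?E\<^sup>*" for e e' v
    using rooted_forest_ancestors_chain[OF T that(3,4)] that(1,2) inj_onD[OF rooted_forest_inj_snd[OF T], of e e']
    by (auto simp: s_def rtrancl_eq_or_trancl)
  have disjoint: "X e \<inter> X e' = {}"
    if "e \<in> ?E" "e' \<in> ?E" "e \<noteq> e'" "(e, e') \<notin> s" "(e', e) \<notin> s" for e e'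
    using comparable[OF that(1,2)] that(3-5) unfolding X_def by blast
  have subset: "X e' \<subseteq> X e" if "(e, e') \<in> s" for e e'
    using that by (auto simp: X_def s_def intro: rtrancl_trans trancl_into_rtrancl)
  have dim: "card {e' \<in> ?E. (e, e') \<in> s} < vec.dim {x \<in> ?R. restrict_to (X e) x = x}" if e: "e \<in> ?E" for e
  proof -
    \<comment> \<open>Paths to leaves of columns outside \<open>X e\<close> avoid \<open>e\<close>
      and everything below it, so the rank of \<open>- X e\<close> is at most
      \<open>card ?E - card ?D\<close>. Restriction to \<open>- X e\<close> has the vectors
      supported in \<open>X e\<close> as kernel, whose dimension is therefore at least
      \<open>card ?D\<close>.\<close>
    let ?D = "insert e {e' \<in> ?E. (e, e') \<in> s}"
    have "(\<Union>j\<in>- X e. root_path_arcs T (f j)) \<subseteq> ?E - ?D"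
      using e by (auto simp: root_path_arcs_eq[OF T f] X_def s_def intro: rtrancl_trans trancl_into_rtrancl)
    then have "card (\<Union>j\<in>- X e. root_path_arcs T (f j)) \<le> card (?E - ?D)"
      using T.pair_finite_arcs by (intro card_mono) auto
    also have "\<dots> = card ?E - card ?D"
      using e T.pair_finite_arcs by (intro card_Diff_subset) auto
    finally have "vec.dim (restrict_to (- X e) ` ?R) \<le> card ?E - card ?D"
      using rank[of "- X e"] by (simp add: matroid_rank_row_space)
    moreover have "vec.dim ?R \<le> vec.dim {x \<in> ?R. restrict_to (- X e) x = 0} + vec.dim (restrict_to (- X e) ` ?R)"
      by (rule dim_le_dim_kernel_plus_image[OF linear_restrict_to vec.subspace_span])
    moreover have "{x \<in> ?R. restrict_to (- X e) x = 0} = {x \<in> ?R. restrict_to (X e) x = x}"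
      by (auto simp: vec_eq_iff)
    moreover have "card ?D = Suc (card {e' \<in> ?E. (e, e') \<in> s})"
      using irreflD[OF irrefl] T.pair_finite_arcs by (subst card_insert_disjoint) auto
    moreover have "card ?D \<le> card ?E"
      using e T.pair_finite_arcs by (intro card_mono) auto
    ultimately show ?thesis
      using card_T by simp
  qed
  obtain y where y: "inj_on y ?E" "vec.independent (y ` ?E)" "\<And>e. e \<in> ?E \<Longrightarrow> y e \<in> ?R"
    "\<And>e. e \<in> ?E \<Longrightarrow> restrict_to (X e) (y e) = y e"
  proof (rule independent_supported_family[OF T.pair_finite_arcs trans \<open>acyclic s\<close>, of X ?R])
    show "X e' \<subseteq> X e" if "(e, e') \<in> s" for e e'
      by (rule subset[OF that])
    show "X e \<inter> X e' = {}"
      if "e \<in> ?E" "e' \<in> ?E" "e \<noteq> e'" "(e, e') \<notin> s" "(e', e) \<notin> s" for e e'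
      by (rule disjoint[OF that])
    show "card {e' \<in> ?E. (e, e') \<in> s} < vec.dim {x \<in> ?R. restrict_to (X e) x = x}" if "e \<in> ?E" for e
      by (rule dim[OF that])
  qed (rule that)
  have supp: "j \<in> X e" if "e \<in> ?E" "y e $ j \<noteq> 0" for e j
    using arg_cong[OF y(4)[OF that(1)], of "\<lambda>x. x $ j"] that(2) by (auto split: if_splits)
  have span_y: "?R \<subseteq> vec.span (y ` ?E)"
  proof (rule vec.card_ge_dim_independent)
    show "y ` ?E \<subseteq> ?R"
      using y(3) by blast
    show "vec.dim ?R \<le> card (y ` ?E)"
      using y(1) card_T by (simp add: card_image)
  qed (rule y(2))
  \<comment> \<open>There are at most as many edges as rows, so distinct edges can be assigned
    distinct rows of a matrix of the same shape as \<open>A\<close>; the rows left over are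
    zero.\<close>
  have "vec.dim (rows A) \<le> card (rows A)"
    using vec.span_superset by (rule vec.dim_le_card) (simp add: rows_eq_image)
  also have "\<dots> \<le> CARD('m)"
    unfolding rows_eq_image by (rule card_image_le) simp
  finally have "card ?E \<le> CARD('m)"
    using card_T by simp
  then obtain \<gamma> :: "'v \<times> 'v \<Rightarrow> 'm" where \<gamma>: "inj_on \<gamma> ?E"
    using card_le_inj[of ?E "UNIV :: 'm set"] T.pair_finite_arcs by auto
  define A' where "A' = (\<chi> i. if i \<in> \<gamma> ` ?E then y (the_inv_into ?E \<gamma> i) else 0)"
  have row_\<gamma>: "row (\<gamma> e) A' = y e" if "e \<in> ?E" for e
    using that \<gamma> by (simp add: A'_def the_inv_into_f_f)
  have row_zero: "row i A' = 0" if "i \<notin> \<gamma> ` ?E" for i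
    using that by (simp add: A'_def)
  have rows_im: "(\<lambda>i. row i A') ` \<gamma> ` ?E = y ` ?E"
    using row_\<gamma> by (auto simp: image_image)
  have "row_equivalent A A'"
  proof (rule row_equivalent_of_span_rows_eq)
    have "rows A' \<subseteq> ?R"
    proof
      fix v assume "v \<in> rows A'"
      then obtain i where i: "v = row i A'"
        by (auto simp: rows_def)
      show "v \<in> ?R"
        using row_\<gamma> row_zero[of i] y(3) by (cases "i \<in> \<gamma> ` ?E") (auto simp: i vec.span_zero)
    qed
    moreover have "y ` ?E \<subseteq> rows A'"
      unfolding rows_im[symmetric] by (auto simp: rows_def)
    ultimately show "?R = vec.span (rows A')"
      using span_y vec.span_mono[of "y ` ?E" "rows A'"] vec.span_minimal[of "rows A'" ?R]
      by (intro antisym) auto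
    show "inj_on (\<lambda>i. row i A') (\<gamma> ` ?E)"
      using y(1) row_\<gamma> by (auto simp: inj_on_def)
    show "vec.independent ((\<lambda>i. row i A') ` \<gamma> ` ?E)"
      unfolding rows_im by (rule y(2))
    show "\<And>i. i \<notin> \<gamma> ` ?E \<Longrightarrow> row i A' = 0"
      by (rule row_zero)
  qed
  \<comment> \<open>Here \<open>A \<noteq> 0\<close> enters. A zero row of \<open>A'\<close> is
    still a vertex of the dual graph and forces height at least 1, whereas a zero matrix has
    branch-depth 0.\<close>
  have pos: "0 < depth T"
  proof -
    obtain i where "row i A \<noteq> 0"
      using \<open>A \<noteq> 0\<close> by (auto simp: row_def vec_eq_iff)
    then have "\<not> rows A \<subseteq> {0}"
      by (auto simp: rows_def)
    then have "card ?E \<noteq> 0"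
      using card_T vec.dim_eq_0[of "rows A"] by simp
    then obtain e where e: "e \<in> ?E"
      by (metis card.empty ex_in_conv)
    then have "e \<in> {e' \<in> ?E. (snd e', snd e) \<in> ?E\<^sup>*}"
      by simp
    moreover have "finite {e' \<in> ?E. (snd e', snd e) \<in> ?E\<^sup>*}"
      using T.pair_finite_arcs by simp
    ultimately have "0 < card {e' \<in> ?E. (snd e', snd e) \<in> ?E\<^sup>*}"
      using card_gt_0_iff by blast
    also have "\<dots> \<le> depth T"
      using e by (intro card_arcs_above_le_depth[OF T] T.arc_snd_in_verts)
    finally show ?thesis .
  qed
  let ?s = "map_prod \<gamma> \<gamma> ` s"
  have s_iff: "(\<gamma> e, \<gamma> e') \<in> ?s \<longleftrightarrow> (e, e') \<in> s" if "e \<in> ?E" "e' \<in> ?E" for e e'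
    using inj_on_image_mem_iff[OF map_prod_inj_on[OF \<gamma> \<gamma>] _ s_subset, of "(e, e')"] that by simp
  have s_cases: "\<exists>e\<in>?E. \<exists>e'\<in>?E. i = \<gamma> e \<and> k = \<gamma> e' \<and> (e, e') \<in> s" if "(i, k) \<in> ?s" for i k
    using that by (auto simp: s_def)
  obtain F :: "nat pair_pre_digraph" and \<phi> where F:
    "rooted_forest F" "closure_embedding \<phi> (dual_graph A') F" "height F \<le> depth T"
  proof (rule ex_closure_embedding[of "dual_graph A'" ?s "depth T"])
    show "finite (pverts (dual_graph A'))" "?s \<subseteq> pverts (dual_graph A') \<times> pverts (dual_graph A')"
      by (simp_all add: dual_graph_def)
    show "trans ?s"
    proof (rule transI)
      fix i k l assume "(i, k) \<in> ?s" "(k, l) \<in> ?s"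
      then obtain e e' e'' where "e \<in> ?E" "e' \<in> ?E" "e'' \<in> ?E" "i = \<gamma> e" "l = \<gamma> e''" "(e, e') \<in> s" "(e', e'') \<in> s"
        using s_cases \<gamma> by (metis inj_onD)
      then show "(i, l) \<in> ?s"
        using trans s_iff by (metis transD)
    qed
    show "irrefl ?s"
      unfolding irrefl_def using s_cases irrefl \<gamma> by (metis inj_onD irrefl_def)
    show "i = k \<or> (i, k) \<in> ?s \<or> (k, i) \<in> ?s" if il: "(i, l) \<in> ?s" and kl: "(k, l) \<in> ?s" for i k l
    proof -
      obtain e e1 where e: "e \<in> ?E" "e1 \<in> ?E" "i = \<gamma> e" "l = \<gamma> e1" "(e, e1) \<in> s"
        using s_cases[OF il] by blast
      obtain e' e2 where e': "e' \<in> ?E" "e2 \<in> ?E" "k = \<gamma> e'" "l = \<gamma> e2" "(e', e2) \<in> s"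
        using s_cases[OF kl] by blast
      have "e1 = e2"
        using e e' inj_onD[OF \<gamma>] by simp
      then have "(snd e, snd e1) \<in> ?E\<^sup>*" "(snd e', snd e1) \<in> ?E\<^sup>*"
        using e(5) e'(5) by (auto simp: s_def intro: trancl_into_rtrancl)
      then have "e = e' \<or> (e, e') \<in> s \<or> (e', e) \<in> s"
        by (rule comparable[OF e(1) e'(1)])
      then show ?thesis
        unfolding e(3) e'(3) s_iff[OF e(1) e'(1)] s_iff[OF e'(1) e(1)] by blast
    qed
    show "(i, k) \<in> ?s \<or> (k, i) \<in> ?s" if ik: "(i, k) \<in> parcs (dual_graph A')" for i k
    proof -
      obtain j where j: "i \<noteq> k" "row i A' $ j \<noteq> 0" "row k A' $ j \<noteq> 0"
        using ik by (auto simp: dual_graph_def row_def)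
      then have "i \<in> \<gamma> ` ?E" "k \<in> \<gamma> ` ?E"
        using row_zero by fastforce+
      then obtain e e' where e: "e \<in> ?E" "e' \<in> ?E" "i = \<gamma> e" "k = \<gamma> e'"
        by auto
      \<comment> \<open>Adjacent rows share a column, which lies in both supports; hence their edges
        are comparable.\<close>
      then have "j \<in> X e \<inter> X e'"
        using j row_\<gamma> supp by auto
      then show ?thesis
        using disjoint[OF e(1,2)] e j(1) by (auto simp: s_iff)
    qed
    show "card {k. (k, i) \<in> ?s} < depth T" for i
    proof (cases "i \<in> \<gamma> ` ?E")
      case True
      then obtain e where e: "e \<in> ?E" "i = \<gamma> e"
        by auto
      \<comment> \<open>\<open>?A\<close> contains \<open>e\<close> itself. Leaving it out gives the
        strict inequality that \<open>ex_closure_embedding\<close> asks for, so edges on a path of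
        \<open>T\<close> become vertices on a path of \<open>F\<close>.\<close>
      let ?A = "{e' \<in> ?E. (snd e', snd e) \<in> ?E\<^sup>*}"
      have "{k. (k, i) \<in> ?s} \<subseteq> \<gamma> ` (?A - {e})"
      proof
        fix k assume "k \<in> {k. (k, i) \<in> ?s}"
        then obtain e' where e': "e' \<in> ?E" "k = \<gamma> e'" "(e', e) \<in> s"
          using s_cases[of k i] e \<gamma> by (auto dest: inj_onD)
        moreover from this have "e' \<noteq> e"
          using irreflD[OF irrefl] by blast
        ultimately have "e' \<in> ?A - {e}"
          by (simp add: s_def trancl_into_rtrancl)
        then show "k \<in> \<gamma> ` (?A - {e})"
          using e'(2) by simp
      qed
      then have "card {k. (k, i) \<in> ?s} \<le> card (?A - {e})"
        using T.pair_finite_arcs by (intro surj_card_le) auto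
      also have "\<dots> < card ?A"
        using e T.pair_finite_arcs by (intro card_Diff1_less) auto
      also have "\<dots> \<le> depth T"
        using e by (intro card_arcs_above_le_depth[OF T] T.arc_snd_in_verts)
      finally show ?thesis .
    next
      case False
      then have "{k. (k, i) \<in> ?s} = {}"
        using s_cases by blast
      then show ?thesis
        using pos by simp
    qed
  qed blast
  have "dual_tree_depth A' \<le> height F"
    unfolding dual_tree_depth_def
    by (rule tree_depth_le_height[OF pair_digraph.pair_wf_digraph[OF pair_digraph_dual_graph] F(1,2)])
  then show ?thesis
    using that \<open>row_equivalent A A'\<close> F(3) by force
qed

theorem theorem1:
  fixes A :: "'a::field ^ 'n ^ 'm"
  assumes "A \<noteq> 0"
  shows "matrix_branch_depth A = (LEAST h. \<exists>A'. row_equivalent A A' \<and> dual_tree_depth A' = h)"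
    (is "_ = ?h")
proof (rule antisym)
  have "\<exists>h A'. row_equivalent A A' \<and> dual_tree_depth A' = h"
    using row_equivalent_refl by blast
  from LeastI_ex[OF this] obtain A' where A': "row_equivalent A A'" "dual_tree_depth A' = ?h"
    by blast
  obtain F :: "nat pair_pre_digraph" and \<phi> where F:
    "rooted_forest F" "closure_embedding \<phi> (dual_graph A') F" "height F = ?h"
    using tree_depth_attained[OF pair_digraph_dual_graph, of A'] A'(2) by (metis dual_tree_depth_def)
  obtain T :: "nat pair_pre_digraph" and f where
    "depth_decomposition UNIV (column_indep A') T f" and depth: "depth T \<le> height F"
    using ex_depth_decomposition[OF F(1,2)] .
  \<comment> \<open>A depth-decomposition sees the matroid only through its rank function, which
    \<open>A\<close> and \<open>A'\<close> share.\<close>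
  then have T: "depth_decomposition UNIV (column_indep A) T f"
    by (simp add: depth_decomposition_def row_equivalent_matroid_rank[OF A'(1)])
  then have "matrix_branch_depth A \<le> depth T"
    unfolding matrix_branch_depth_def branch_depth_def by (intro Least_le) blast
  then show "matrix_branch_depth A \<le> ?h"
    using depth F(3) by simp
  \<comment> \<open>The decomposition obtained for the first inequality also shows that the minimum
    defining the branch-depth is attained.\<close>
  have "\<exists>d (T :: nat pair_pre_digraph) f. depth_decomposition UNIV (column_indep A) T f \<and> depth T = d"
    using T by blast
  from LeastI_ex[OF this] obtain T' :: "nat pair_pre_digraph" and f' where
    T': "depth_decomposition UNIV (column_indep A) T' f'" "depth T' = matrix_branch_depth A"
    unfolding matrix_branch_depth_def branch_depth_def by blast
  obtain B where "row_equivalent A B" "dual_tree_depth B \<le> depth T'"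
    using ex_row_equivalent_tree_depth_le[OF assms T'(1)] .
  then have "?h \<le> depth T'"
    using Least_le[of "\<lambda>h. \<exists>A'. row_equivalent A A' \<and> dual_tree_depth A' = h" "dual_tree_depth B"] by force
  then show "?h \<le> matrix_branch_depth A"
    using T'(2) by simp
qed

end
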